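(* Let $\mathcal{C}$ be a pointed, regular and weakly Mal'tsev category. The following conditions are equivalent: (iv) for every object $B$ of $\mathcal{C}$, the kernel functor $\mathrm{Ker}_B\colon \mathsf{Pt}_B(\mathcal{C})\to\mathcal{C}$ reflects Huq-commutativity of cospans, that is: for every cospan $(x,y)$ in $\mathsf{Pt}_B(\mathcal{C})$, if $\mathrm{Ker}_B(x)$ and $\mathrm{Ker}_B(y)$ commute in $\mathcal{C}$ in the Huq sense, then $x$ and $y$ commute in $\mathsf{Pt}_B(\mathcal{C})$ in the Huq sense; (v) a pair of left split relations over the same objects commutes as soon as their zero-classes do, that is: for all objects $B$, $D$ of $\mathcal{C}$ and all left split relations $(f\colon A\to B,\ \alpha\colon A\to D,\ r\colon B\to A)$ and $(g\colon C\to B,\ \gamma\colon C\to D,\ s\colon B\to C)$ from $B$ to $D$, if their zero-classes commute in the Huq sense, then the two left split relations commute; (vi) a pair of left split spans over the same objects commutes as soon as their zero-classes do, that is: the same condition as (v), for all left split spans $(f,\alpha,r)$ and $(g,\gamma,s)$ from $B$ to $D$.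
   Context: A category is pointed if it has a zero object; $0$ also denotes zero morphisms. A regular category is a finitely complete category with pullback-stable (regular epimorphism, monomorphism) factorisations. A finitely complete category is weakly Mal'tsev if, for all $f\colon A\to B$, $r\colon B\to A$, $g\colon C\to B$, $s\colon B\to C$ with $fr=1_B=gs$, the morphisms $e_1=\langle 1_A,sf\rangle\colon A\to A\times_B C$ and $e_2=\langle rg,1_C\rangle\colon C\to A\times_B C$ into the pullback of $f$ and $g$ are jointly epimorphic. A span $(d\colon R\to X,\ c\colon R\to Y)$ from $X$ to $Y$ is a relation if $d,c$ are jointly monomorphic. The zero-class of a span $(d,c)$ from $X$ to $Y$ is the morphism $i\colon I\to Y$ obtained as the pullback of $\langle d,c\rangle\colon R\to X\times Y$ along $\langle 0,1_Y\rangle\colon Y\to X\times Y$ (unique up to isomorphism). A left split span from $X$ to $Y$ is a triple $(d\colon R\to X,\ c\colon R\to Y,\ e\colon X\to R)$ with $de=1_X$; its zero-class is that of $(d,c)$. It is a left split relation if $(d,c)$ is a relation. Two left split spans $(f\colon A\to B,\alpha\colon A\to D,r\colon B\to A)$ and $(g\colon C\to B,\gamma\colon C\to D,s\colon B\to C)$ from $B$ to $D$ commute if there is a (necessarily unique) morphism $\varphi\colon A\times_B C\to D$ with $\varphi e_1=\alpha$ and $\varphi e_2=\gamma$, where $A\times_B C$ is the pullback of $f$ and $g$, $e_1=\langle 1_A,sf\rangle$ and $e_2=\langle rg,1_C\rangle$. (When this happens, $\gamma s=\alpha r$.) Two morphisms $\alpha\colon A\to D$, $\gamma\colon C\to D$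 in a pointed weakly Mal'tsev category commute in the Huq sense if there is a (necessarily unique) $\varphi\colon A\times C\to D$ with $\varphi\langle 1_A,0\rangle=\alpha$ and $\varphi\langle 0,1_C\rangle=\gamma$. For an object $B$, $\mathsf{Pt}_B(\mathcal{C})$ is the category of points over $B$: objects are pairs $(p\colon E\to B,\ s\colon B\to E)$ with $ps=1_B$; a morphism $(p\colon E\to B,s)\to(p'\colon E'\to B,s')$ is a morphism $f\colon E\to E'$ in $\mathcal{C}$ with $p'f=p$ and $fs=s'$. It is again a pointed, regular, weakly Mal'tsev category, with zero object $(1_B,1_B)$ and products given by pullbacks over $B$; Huq-commutativity in $\mathsf{Pt}_B(\mathcal{C})$ is taken in this category. The kernel functor $\mathrm{Ker}_B\colon\mathsf{Pt}_B(\mathcal{C})\to\mathcal{C}$ sends $(p,s)$ to the kernel of $p$, and a morphism to the induced morphism between kernels.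
   Formalization: Conditions (v) and (vi) are stated only for pairs with αr = γs, which is necessary for commuting. Without it, (1,α,1) and (1,γ,1) have commuting zero-classes 0→D but commute only if α = γ, so (v) fails in groups, where (iv) holds. *)

theory Defs
  imports Main
begin

section \<open>Categories, functors and limits\<close>

record ('o, 'm) cat =
  ob  :: "'o set"
  mor :: "'m set"
  src :: "'m \<Rightarrow> 'o"
  tgt :: "'m \<Rightarrow> 'o"
  ide :: "'o \<Rightarrow> 'm"
  cmp :: "'m \<Rightarrow> 'm \<Rightarrow> 'm"  (infixr "\<cdot>\<index>" 70)

definition hom :: "('o, 'm) cat \<Rightarrow> 'o \<Rightarrow> 'o \<Rightarrow> 'm set" where
  "hom C A B = {f \<in> mor C. src C f = A \<and> tgt C f = B}"

text \<open>Composition is written in applicative order; its values on non-composable pairs are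
  irrelevant.\<close>

locale category =
  fixes C :: "('o, 'm) cat" (structure)
  assumes src_in_ob: "f \<in> mor C \<Longrightarrow> src C f \<in> ob C"
    and tgt_in_ob: "f \<in> mor C \<Longrightarrow> tgt C f \<in> ob C"
    and ide_in_hom: "A \<in> ob C \<Longrightarrow> ide C A \<in> hom C A A"
    and cmp_in_hom: "\<lbrakk>f \<in> hom C A B; g \<in> hom C B D\<rbrakk> \<Longrightarrow> g \<cdot> f \<in> hom C A D"
    and cmp_ide_left: "f \<in> hom C A B \<Longrightarrow> ide C B \<cdot> f = f"
    and cmp_ide_right: "f \<in> hom C A B \<Longrightarrow> f \<cdot> ide C A = f"
    and cmp_assoc: "\<lbrakk>f \<in> hom C A B; g \<in> hom C B D; h \<in> hom C D E\<rbrakk>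
      \<Longrightarrow> (h \<cdot> g) \<cdot> f = h \<cdot> (g \<cdot> f)"

definition is_functor ::
  "('i, 'a) cat \<Rightarrow> ('o, 'm) cat \<Rightarrow> ('i \<Rightarrow> 'o) \<Rightarrow> ('a \<Rightarrow> 'm) \<Rightarrow> bool" where
  "is_functor J C F\<^sub>o F\<^sub>m \<longleftrightarrow>
     (\<forall>j\<in>ob J. F\<^sub>o j \<in> ob C) \<and>
     (\<forall>u\<in>mor J. F\<^sub>m u \<in> hom C (F\<^sub>o (src J u)) (F\<^sub>o (tgt J u))) \<and>
     (\<forall>j\<in>ob J. F\<^sub>m (ide J j) = ide C (F\<^sub>o j)) \<and>
     (\<forall>u\<in>mor J. \<forall>v\<in>mor J. tgt J u = src J v \<longrightarrow>
        F\<^sub>m (v \<cdot>\<^bsub>J\<^esub> u) = F\<^sub>m v \<cdot>\<^bsub>C\<^esub> F\<^sub>m u)"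

definition is_cone ::
  "('i, 'a) cat \<Rightarrow> ('o, 'm) cat \<Rightarrow> ('i \<Rightarrow> 'o) \<Rightarrow> ('a \<Rightarrow> 'm) \<Rightarrow> 'o \<Rightarrow> ('i \<Rightarrow> 'm) \<Rightarrow> bool" where
  "is_cone J C F\<^sub>o F\<^sub>m L \<pi> \<longleftrightarrow>
     L \<in> ob C \<and> (\<forall>j\<in>ob J. \<pi> j \<in> hom C L (F\<^sub>o j)) \<and>
     (\<forall>u\<in>mor J. F\<^sub>m u \<cdot>\<^bsub>C\<^esub> \<pi> (src J u) = \<pi> (tgt J u))"

definition is_limit ::
  "('i, 'a) cat \<Rightarrow> ('o, 'm) cat \<Rightarrow> ('i \<Rightarrow> 'o) \<Rightarrow> ('a \<Rightarrow> 'm) \<Rightarrow> 'o \<Rightarrow> ('i \<Rightarrow> 'm) \<Rightarrow> bool" where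
  "is_limit J C F\<^sub>o F\<^sub>m L \<pi> \<longleftrightarrow>
     is_cone J C F\<^sub>o F\<^sub>m L \<pi> \<and>
     (\<forall>L' \<pi>'. is_cone J C F\<^sub>o F\<^sub>m L' \<pi>' \<longrightarrow>
        (\<exists>!h. h \<in> hom C L' L \<and> (\<forall>j\<in>ob J. \<pi> j \<cdot>\<^bsub>C\<^esub> h = \<pi>' j)))"

text \<open>Every finite category is isomorphic to one whose objects and morphisms are natural numbers,
  so quantifying over index categories of type \<open>(nat, nat) cat\<close> covers all finite diagrams.\<close>

definition finitely_complete :: "('o, 'm) cat \<Rightarrow> bool" where
  "finitely_complete C \<longleftrightarrow>
     category C \<and>
     (\<forall>(J :: (nat, nat) cat) F\<^sub>o F\<^sub>m.
        category J \<and> finite (ob J) \<and> finite (mor J) \<and> is_functor J C F\<^sub>o F\<^sub>m \<longrightarrow>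
        (\<exists>L \<pi>. is_limit J C F\<^sub>o F\<^sub>m L \<pi>))"

text \<open>In \<open>is_product\<close> and \<open>is_pullback\<close> the product (pullback) object is the common source of the
  two projections \<open>p\<close>, \<open>q\<close>; \<open>pair C p q u v\<close> is the induced morphism \<open>\<langle>u, v\<rangle>\<close> into it.\<close>

definition is_product :: "('o, 'm) cat \<Rightarrow> 'o \<Rightarrow> 'o \<Rightarrow> 'm \<Rightarrow> 'm \<Rightarrow> bool" where
  "is_product C A B p q \<longleftrightarrow>
     p \<in> hom C (src C p) A \<and> q \<in> hom C (src C p) B \<and>
     (\<forall>Q. \<forall>u\<in>hom C Q A. \<forall>v\<in>hom C Q B.
        \<exists>!h. h \<in> hom C Q (src C p) \<and> p \<cdot>\<^bsub>C\<^esub> h = u \<and> q \<cdot>\<^bsub>C\<^esub> h = v)"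

definition is_pullback :: "('o, 'm) cat \<Rightarrow> 'm \<Rightarrow> 'm \<Rightarrow> 'm \<Rightarrow> 'm \<Rightarrow> bool" where
  "is_pullback C f g p q \<longleftrightarrow>
     f \<in> mor C \<and> g \<in> mor C \<and> tgt C f = tgt C g \<and>
     p \<in> hom C (src C p) (src C f) \<and> q \<in> hom C (src C p) (src C g) \<and>
     f \<cdot>\<^bsub>C\<^esub> p = g \<cdot>\<^bsub>C\<^esub> q \<and>
     (\<forall>Q. \<forall>u\<in>hom C Q (src C f). \<forall>v\<in>hom C Q (src C g). f \<cdot>\<^bsub>C\<^esub> u = g \<cdot>\<^bsub>C\<^esub> v \<longrightarrow>
        (\<exists>!h. h \<in> hom C Q (src C p) \<and> p \<cdot>\<^bsub>C\<^esub> h = u \<and> q \<cdot>\<^bsub>C\<^esub> h = v))"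

definition pair :: "('o, 'm) cat \<Rightarrow> 'm \<Rightarrow> 'm \<Rightarrow> 'm \<Rightarrow> 'm \<Rightarrow> 'm" where
  "pair C p q u v =
     (THE h. h \<in> hom C (src C u) (src C p) \<and> p \<cdot>\<^bsub>C\<^esub> h = u \<and> q \<cdot>\<^bsub>C\<^esub> h = v)"

definition is_mono :: "('o, 'm) cat \<Rightarrow> 'm \<Rightarrow> bool" where
  "is_mono C m \<longleftrightarrow>
     m \<in> mor C \<and>
     (\<forall>Q. \<forall>u\<in>hom C Q (src C m). \<forall>v\<in>hom C Q (src C m).
        m \<cdot>\<^bsub>C\<^esub> u = m \<cdot>\<^bsub>C\<^esub> v \<longrightarrow> u = v)"

definition jointly_monic :: "('o, 'm) cat \<Rightarrow> 'm \<Rightarrow> 'm \<Rightarrow> bool" where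
  "jointly_monic C d c \<longleftrightarrow>
     d \<in> mor C \<and> c \<in> mor C \<and> src C d = src C c \<and>
     (\<forall>Q. \<forall>u\<in>hom C Q (src C d). \<forall>v\<in>hom C Q (src C d).
        d \<cdot>\<^bsub>C\<^esub> u = d \<cdot>\<^bsub>C\<^esub> v \<and> c \<cdot>\<^bsub>C\<^esub> u = c \<cdot>\<^bsub>C\<^esub> v \<longrightarrow> u = v)"

definition jointly_epic :: "('o, 'm) cat \<Rightarrow> 'm \<Rightarrow> 'm \<Rightarrow> bool" where
  "jointly_epic C e\<^sub>1 e\<^sub>2 \<longleftrightarrow>
     e\<^sub>1 \<in> mor C \<and> e\<^sub>2 \<in> mor C \<and> tgt C e\<^sub>1 = tgt C e\<^sub>2 \<and>
     (\<forall>Q. \<forall>u\<in>hom C (tgt C e\<^sub>1) Q. \<forall>v\<in>hom C (tgt C e\<^sub>1) Q.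
        u \<cdot>\<^bsub>C\<^esub> e\<^sub>1 = v \<cdot>\<^bsub>C\<^esub> e\<^sub>1 \<and> u \<cdot>\<^bsub>C\<^esub> e\<^sub>2 = v \<cdot>\<^bsub>C\<^esub> e\<^sub>2 \<longrightarrow> u = v)"

definition is_coequalizer :: "('o, 'm) cat \<Rightarrow> 'm \<Rightarrow> 'm \<Rightarrow> 'm \<Rightarrow> bool" where
  "is_coequalizer C u v e \<longleftrightarrow>
     u \<in> mor C \<and> v \<in> hom C (src C u) (tgt C u) \<and>
     e \<in> hom C (tgt C u) (tgt C e) \<and> e \<cdot>\<^bsub>C\<^esub> u = e \<cdot>\<^bsub>C\<^esub> v \<and>
     (\<forall>Q. \<forall>w\<in>hom C (tgt C u) Q. w \<cdot>\<^bsub>C\<^esub> u = w \<cdot>\<^bsub>C\<^esub> v \<longrightarrow>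
        (\<exists>!h. h \<in> hom C (tgt C e) Q \<and> h \<cdot>\<^bsub>C\<^esub> e = w))"

definition regular_epi :: "('o, 'm) cat \<Rightarrow> 'm \<Rightarrow> bool" where
  "regular_epi C e \<longleftrightarrow> (\<exists>u v. is_coequalizer C u v e)"


section \<open>Pointed, regular and weakly Mal'tsev categories\<close>

definition zero_object :: "('o, 'm) cat \<Rightarrow> 'o \<Rightarrow> bool" where
  "zero_object C Z \<longleftrightarrow>
     Z \<in> ob C \<and> (\<forall>A\<in>ob C. (\<exists>!f. f \<in> hom C A Z) \<and> (\<exists>!f. f \<in> hom C Z A))"

definition pointed :: "('o, 'm) cat \<Rightarrow> bool" where
  "pointed C \<longleftrightarrow> category C \<and> (\<exists>Z. zero_object C Z)"

definition zero_mor :: "('o, 'm) cat \<Rightarrow> 'o \<Rightarrow> 'o \<Rightarrow> 'm" where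
  "zero_mor C A B =
     (THE f. \<exists>Z u v. zero_object C Z \<and> u \<in> hom C A Z \<and> v \<in> hom C Z B \<and> f = v \<cdot>\<^bsub>C\<^esub> u)"

definition regular_factorisation :: "('o, 'm) cat \<Rightarrow> 'm \<Rightarrow> 'm \<Rightarrow> 'm \<Rightarrow> bool" where
  "regular_factorisation C f e m \<longleftrightarrow>
     regular_epi C e \<and> is_mono C m \<and> tgt C e = src C m \<and> f = m \<cdot>\<^bsub>C\<^esub> e"

text \<open>Pullback-stability: for \<open>f = m \<cdot> e\<close> as above and \<open>g\<close> with the same target as \<open>f\<close>, first pull back
  \<open>m\<close> along \<open>g\<close> (giving \<open>m'\<close>) and then \<open>e\<close> along the resulting projection \<open>h\<close> (giving \<open>e'\<close>). By the
  pasting law \<open>m' \<cdot> e'\<close> is the pullback of \<open>f\<close> along \<open>g\<close>.\<close>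

definition regular :: "('o, 'm) cat \<Rightarrow> bool" where
  "regular C \<longleftrightarrow>
     finitely_complete C \<and>
     (\<forall>f\<in>mor C. \<exists>e m. regular_factorisation C f e m) \<and>
     (\<forall>f e m g m' h e' k.
        regular_factorisation C f e m \<and> is_pullback C m g h m' \<and> is_pullback C e h k e' \<longrightarrow>
        regular_factorisation C (m' \<cdot>\<^bsub>C\<^esub> e') e' m')"

text \<open>For split epimorphisms \<open>f\<close>, \<open>g\<close> with sections \<open>r\<close>, \<open>s\<close> and a pullback \<open>(p, q)\<close> of \<open>f\<close> and \<open>g\<close>:
  the morphisms \<open>e\<^sub>1 = \<langle>1, s f\<rangle>\<close> and \<open>e\<^sub>2 = \<langle>r g, 1\<rangle>\<close> into that pullback.\<close>

definition e1 :: "('o, 'm) cat \<Rightarrow> 'm \<Rightarrow> 'm \<Rightarrow> 'm \<Rightarrow> 'm \<Rightarrow> 'm" where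
  "e1 C p q f s = pair C p q (ide C (src C f)) (s \<cdot>\<^bsub>C\<^esub> f)"

definition e2 :: "('o, 'm) cat \<Rightarrow> 'm \<Rightarrow> 'm \<Rightarrow> 'm \<Rightarrow> 'm \<Rightarrow> 'm" where
  "e2 C p q g r = pair C p q (r \<cdot>\<^bsub>C\<^esub> g) (ide C (src C g))"

definition weakly_maltsev :: "('o, 'm) cat \<Rightarrow> bool" where
  "weakly_maltsev C \<longleftrightarrow>
     finitely_complete C \<and>
     (\<forall>A B D. \<forall>f\<in>hom C A B. \<forall>r\<in>hom C B A. \<forall>g\<in>hom C D B. \<forall>s\<in>hom C B D.
        f \<cdot>\<^bsub>C\<^esub> r = ide C B \<and> g \<cdot>\<^bsub>C\<^esub> s = ide C B \<longrightarrow>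
        (\<forall>p q. is_pullback C f g p q \<longrightarrow> jointly_epic C (e1 C p q f s) (e2 C p q g r)))"


section \<open>Commuting morphisms and left split spans\<close>

text \<open>Limits are only determined up to isomorphism, so the definitions below ask for some product
  (pullback); by its universal property the choice is immaterial.\<close>

definition huq_commute :: "('o, 'm) cat \<Rightarrow> 'm \<Rightarrow> 'm \<Rightarrow> bool" where
  "huq_commute C \<alpha> \<gamma> \<longleftrightarrow>
     \<alpha> \<in> mor C \<and> \<gamma> \<in> mor C \<and> tgt C \<alpha> = tgt C \<gamma> \<and>
     (\<exists>p q. is_product C (src C \<alpha>) (src C \<gamma>) p q \<and>
        (\<exists>\<phi>\<in>hom C (src C p) (tgt C \<alpha>).
           \<phi> \<cdot>\<^bsub>C\<^esub> pair C p q (ide C (src C \<alpha>)) (zero_mor C (src C \<alpha>) (src C \<gamma>)) = \<alpha> \<and>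
           \<phi> \<cdot>\<^bsub>C\<^esub> pair C p q (zero_mor C (src C \<gamma>) (src C \<alpha>)) (ide C (src C \<gamma>)) = \<gamma>))"

definition is_zero_class :: "('o, 'm) cat \<Rightarrow> 'm \<Rightarrow> 'm \<Rightarrow> 'm \<Rightarrow> bool" where
  "is_zero_class C d c i \<longleftrightarrow>
     (let X = tgt C d; Y = tgt C c in
      \<exists>p q k. is_product C X Y p q \<and>
        is_pullback C (pair C p q d c) (pair C p q (zero_mor C Y X) (ide C Y)) k i)"

definition left_split_span :: "('o, 'm) cat \<Rightarrow> 'o \<Rightarrow> 'o \<Rightarrow> 'm \<Rightarrow> 'm \<Rightarrow> 'm \<Rightarrow> bool" where
  "left_split_span C X Y d c e \<longleftrightarrow>
     d \<in> hom C (src C d) X \<and> c \<in> hom C (src C d) Y \<and> e \<in> hom C X (src C d) \<and>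
     d \<cdot>\<^bsub>C\<^esub> e = ide C X"

definition left_split_relation :: "('o, 'm) cat \<Rightarrow> 'o \<Rightarrow> 'o \<Rightarrow> 'm \<Rightarrow> 'm \<Rightarrow> 'm \<Rightarrow> bool" where
  "left_split_relation C X Y d c e \<longleftrightarrow> left_split_span C X Y d c e \<and> jointly_monic C d c"

text \<open>If two left split spans commute, then \<open>\<alpha> r = \<gamma> s\<close>. This is not a consequence of their
  zero-classes commuting: for any \<open>\<alpha>, \<gamma> : B \<rightarrow> D\<close> the left split relations \<open>(1, \<alpha>, 1)\<close> and
  \<open>(1, \<gamma>, 1)\<close> both have zero-class \<open>0 \<rightarrow> D\<close>, whereas they commute only if \<open>\<alpha> = \<gamma>\<close>.
  Statements deducing the former from the latter therefore need \<open>\<alpha> r = \<gamma> s\<close> as a hypothesis.\<close>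

definition left_split_commute ::
  "('o, 'm) cat \<Rightarrow> 'm \<Rightarrow> 'm \<Rightarrow> 'm \<Rightarrow> 'm \<Rightarrow> 'm \<Rightarrow> 'm \<Rightarrow> bool" where
  "left_split_commute C f \<alpha> r g \<gamma> s \<longleftrightarrow>
     (\<exists>p q. is_pullback C f g p q \<and>
        (\<exists>\<phi>\<in>hom C (src C p) (tgt C \<alpha>).
           \<phi> \<cdot>\<^bsub>C\<^esub> e1 C p q f s = \<alpha> \<and> \<phi> \<cdot>\<^bsub>C\<^esub> e2 C p q g r = \<gamma>))"

section \<open>Points and the kernel functor\<close>

definition is_point :: "('o, 'm) cat \<Rightarrow> 'o \<Rightarrow> 'm \<times> 'm \<Rightarrow> bool" where
  "is_point C B = (\<lambda>(p, s).
     p \<in> hom C (src C p) B \<and> s \<in> hom C B (src C p) \<and> p \<cdot>\<^bsub>C\<^esub> s = ide C B)"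

definition is_point_mor :: "('o, 'm) cat \<Rightarrow> 'm \<times> 'm \<Rightarrow> 'm \<Rightarrow> 'm \<times> 'm \<Rightarrow> bool" where
  "is_point_mor C = (\<lambda>(p, s) f (p', s').
     f \<in> hom C (src C p) (src C p') \<and> p' \<cdot>\<^bsub>C\<^esub> f = p \<and> f \<cdot>\<^bsub>C\<^esub> s = s')"

text \<open>A morphism of points carries its source and target.\<close>

definition Pt ::
  "('o, 'm) cat \<Rightarrow> 'o \<Rightarrow> ('m \<times> 'm, ('m \<times> 'm) \<times> 'm \<times> ('m \<times> 'm)) cat" where
  "Pt C B = \<lparr>
     ob = {P. is_point C B P},
     mor = {(P, f, P'). is_point C B P \<and> is_point C B P' \<and> is_point_mor C P f P'},
     src = (\<lambda>(P, f, P'). P),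
     tgt = (\<lambda>(P, f, P'). P'),
     ide = (\<lambda>P. (P, ide C (src C (fst P)), P)),
     cmp = (\<lambda>(P', g, P'') (P, f, _). (P, g \<cdot>\<^bsub>C\<^esub> f, P''))\<rparr>"

definition is_kernel :: "('o, 'm) cat \<Rightarrow> 'm \<Rightarrow> 'm \<Rightarrow> bool" where
  "is_kernel C f k \<longleftrightarrow>
     f \<in> mor C \<and> k \<in> hom C (src C k) (src C f) \<and>
     f \<cdot>\<^bsub>C\<^esub> k = zero_mor C (src C k) (tgt C f) \<and>
     (\<forall>Q. \<forall>u\<in>hom C Q (src C f). f \<cdot>\<^bsub>C\<^esub> u = zero_mor C Q (tgt C f) \<longrightarrow>
        (\<exists>!h. h \<in> hom C Q (src C k) \<and> k \<cdot>\<^bsub>C\<^esub> h = u))"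

definition ker :: "('o, 'm) cat \<Rightarrow> 'm \<Rightarrow> 'm" where
  "ker C f = (SOME k. is_kernel C f k)"

text \<open>The kernel functor, on objects and on morphisms, for a choice of kernels. The base object
  is the target of the split epimorphism of a point, hence not an argument.\<close>

definition Ker_ob :: "('o, 'm) cat \<Rightarrow> 'm \<times> 'm \<Rightarrow> 'o" where
  "Ker_ob C P = src C (ker C (fst P))"

definition Ker_mor :: "('o, 'm) cat \<Rightarrow> ('m \<times> 'm) \<times> 'm \<times> ('m \<times> 'm) \<Rightarrow> 'm" where
  "Ker_mor C = (\<lambda>(P, f, P'). THE h. h \<in> hom C (Ker_ob C P) (Ker_ob C P') \<and>
     ker C (fst P') \<cdot>\<^bsub>C\<^esub> h = f \<cdot>\<^bsub>C\<^esub> ker C (fst P))"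


section \<open>The three conditions\<close>

definition Ker_reflects_huq :: "('o, 'm) cat \<Rightarrow> bool" where
  "Ker_reflects_huq C \<longleftrightarrow>
     (\<forall>B\<in>ob C. \<forall>x\<in>mor (Pt C B). \<forall>y\<in>mor (Pt C B).
        tgt (Pt C B) x = tgt (Pt C B) y \<longrightarrow>
        huq_commute C (Ker_mor C x) (Ker_mor C y) \<longrightarrow> huq_commute (Pt C B) x y)"

definition split_relations_commute_if_zero_classes_do :: "('o, 'm) cat \<Rightarrow> bool" where
  "split_relations_commute_if_zero_classes_do C \<longleftrightarrow>
     (\<forall>B\<in>ob C. \<forall>D\<in>ob C. \<forall>f \<alpha> r g \<gamma> s.
        left_split_relation C B D f \<alpha> r \<longrightarrow> left_split_relation C B D g \<gamma> s \<longrightarrow>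
        \<alpha> \<cdot>\<^bsub>C\<^esub> r = \<gamma> \<cdot>\<^bsub>C\<^esub> s \<longrightarrow>
        (\<forall>i j. is_zero_class C f \<alpha> i \<and> is_zero_class C g \<gamma> j \<and> huq_commute C i j \<longrightarrow>
           left_split_commute C f \<alpha> r g \<gamma> s))"

definition split_spans_commute_if_zero_classes_do :: "('o, 'm) cat \<Rightarrow> bool" where
  "split_spans_commute_if_zero_classes_do C \<longleftrightarrow>
     (\<forall>B\<in>ob C. \<forall>D\<in>ob C. \<forall>f \<alpha> r g \<gamma> s.
        left_split_span C B D f \<alpha> r \<longrightarrow> left_split_span C B D g \<gamma> s \<longrightarrow>
        \<alpha> \<cdot>\<^bsub>C\<^esub> r = \<gamma> \<cdot>\<^bsub>C\<^esub> s \<longrightarrow>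
        (\<forall>i j. is_zero_class C f \<alpha> i \<and> is_zero_class C g \<gamma> j \<and> huq_commute C i j \<longrightarrow>
           left_split_commute C f \<alpha> r g \<gamma> s))"

end

theory Submission
  imports Defs
begin

text \<open>Two dictionaries turn the three conditions into statements about the same data. First, the
  zero-class of \<open>(d, c)\<close> is \<open>c k\<close> for \<open>k\<close> the kernel of \<open>d\<close> (\<open>zero_class_iff\<close>). Secondly, two morphisms
  of points with common target commute in the Huq sense exactly when they commute as left split
  spans (\<open>huq_commute_Pt_iff_left_split_commute\<close>).

  For a cospan \<open>x : (f, r) \<rightarrow> (t, \<sigma>) \<leftarrow> (g, s) : y\<close> of points, the zero-classes of the left split spans
  \<open>(f, x, r)\<close> and \<open>(g, y, s)\<close> are \<open>Ker x\<close> and \<open>Ker y\<close> followed by the kernel of \<open>t\<close>, so the condition on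
  left split spans gives reflection of Huq-commutativity. Conversely, left split spans \<open>(f, \<alpha>, r)\<close>
  and \<open>(g, \<gamma>, s)\<close> from \<open>B\<close> to \<open>D\<close> with \<open>\<alpha> r = \<gamma> s\<close> are a cospan \<open>\<langle>f, \<alpha>\<rangle>\<close>, \<open>\<langle>g, \<gamma>\<rangle>\<close> of points with target
  \<open>(B \<times> D \<rightarrow> B, \<langle>1, \<alpha> r\<rangle>)\<close>. The kernel of that projection is \<open>D\<close>, and the kernel functor sends the
  cospan to the two zero-classes.

  To pass from relations to spans, replace \<open>(f, \<alpha>)\<close> by the relation \<open>(f', \<alpha>')\<close> with \<open>f = f' e\<close> and
  \<open>\<alpha> = \<alpha>' e\<close> given by the regular image of \<open>\<langle>f, \<alpha>\<rangle>\<close> (\<open>relation_of_split_span\<close>). The comparison between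
  the domains of the zero-classes is a pullback of \<open>e\<close>, hence a regular epimorphism, and
  Huq-commutativity descends along regular epimorphisms (\<open>huq_commute_descends\<close>). So the
  zero-classes of the two relations commute, therefore the relations do, and precomposing with
  the regular epimorphisms shows that the spans commute. The descent step is the one that
  combines regularity with the weak Mal'tsev condition.\<close>

section \<open>Composition, pullbacks and products\<close>

context category
begin

lemma homD: "f \<in> hom C A B \<Longrightarrow> f \<in> mor C \<and> src C f = A \<and> tgt C f = B"
  by (simp add: hom_def)

lemma hom_src: "f \<in> hom C A B \<Longrightarrow> src C f = A"
  by (simp add: hom_def)

lemma hom_tgt: "f \<in> hom C A B \<Longrightarrow> tgt C f = B"
  by (simp add: hom_def)

lemma hom_ob: "f \<in> hom C A B \<Longrightarrow> A \<in> ob C \<and> B \<in> ob C"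
  using src_in_ob tgt_in_ob by (auto simp: hom_def)

lemma mor_in_hom: "f \<in> mor C \<Longrightarrow> f \<in> hom C (src C f) (tgt C f)"
  by (simp add: hom_def)

lemma cmp_reassoc:
  assumes "p \<cdot> h = u" "w \<in> hom C Q X" "h \<in> hom C X Y" "p \<in> hom C Y Z"
  shows "p \<cdot> (h \<cdot> w) = u \<cdot> w"
  using assms cmp_assoc by metis

lemma pullbackD:
  assumes "is_pullback C f g p q" "f \<in> hom C A B"
  shows "g \<in> hom C (src C g) B" "p \<in> hom C (src C p) A" "q \<in> hom C (src C p) (src C g)"
    "f \<cdot> p = g \<cdot> q"
  using assms by (auto simp: is_pullback_def hom_def)

lemma pullback_eqI:
  assumes "is_pullback C f g p q" "u \<in> hom C Q (src C p)" "v \<in> hom C Q (src C p)"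
    "p \<cdot> u = p \<cdot> v" "q \<cdot> u = q \<cdot> v"
  shows "u = v"
proof -
  have pq: "p \<in> hom C (src C p) (src C f)" "q \<in> hom C (src C p) (src C g)"
    and fg: "f \<in> hom C (src C f) (tgt C f)" "g \<in> hom C (src C g) (tgt C f)"
    and eq: "f \<cdot> p = g \<cdot> q"
    and ex: "\<And>Q u v. u \<in> hom C Q (src C f) \<Longrightarrow> v \<in> hom C Q (src C g) \<Longrightarrow> f \<cdot> u = g \<cdot> v \<Longrightarrow>
        \<exists>!h. h \<in> hom C Q (src C p) \<and> p \<cdot> h = u \<and> q \<cdot> h = v"
    using assms(1) unfolding is_pullback_def hom_def by auto
  have "f \<cdot> (p \<cdot> u) = g \<cdot> (q \<cdot> u)"
    using cmp_assoc[OF assms(2) pq(1) fg(1)] cmp_assoc[OF assms(2) pq(2) fg(2)] eq by simp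
  from ex[OF cmp_in_hom[OF assms(2) pq(1)] cmp_in_hom[OF assms(2) pq(2)] this]
  show ?thesis using assms by metis
qed

lemma pullback_ex:
  assumes "is_pullback C f g p q" "f \<in> hom C A B" "g \<in> hom C D B"
    "u \<in> hom C Q A" "v \<in> hom C Q D" "f \<cdot> u = g \<cdot> v"
  shows "\<exists>h \<in> hom C Q (src C p). p \<cdot> h = u \<and> q \<cdot> h = v"
  using assms unfolding is_pullback_def by (metis hom_src)

lemma pullback_pair:
  assumes "is_pullback C f g p q" "f \<in> hom C A B" "g \<in> hom C D B"
    "u \<in> hom C Q A" "v \<in> hom C Q D" "f \<cdot> u = g \<cdot> v"
  shows "pair C p q u v \<in> hom C Q (src C p)" "p \<cdot> pair C p q u v = u" "q \<cdot> pair C p q u v = v"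
proof -
  have "\<exists>!h. h \<in> hom C (src C u) (src C p) \<and> p \<cdot> h = u \<and> q \<cdot> h = v"
    using pullback_ex[OF assms] pullback_eqI[OF assms(1)] hom_src[OF assms(4)] by metis
  from theI'[OF this] show "pair C p q u v \<in> hom C Q (src C p)"
    "p \<cdot> pair C p q u v = u" "q \<cdot> pair C p q u v = v"
    unfolding pair_def using hom_src[OF assms(4)] by simp_all
qed

lemma pullbackI:
  assumes "f \<in> hom C A B" "g \<in> hom C D B" "p \<in> hom C P A" "q \<in> hom C P D" "f \<cdot> p = g \<cdot> q"
    and "\<And>Q u v. u \<in> hom C Q A \<Longrightarrow> v \<in> hom C Q D \<Longrightarrow> f \<cdot> u = g \<cdot> v \<Longrightarrow>
      \<exists>h \<in> hom C Q P. p \<cdot> h = u \<and> q \<cdot> h = v"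
    and "\<And>Q h h'. h \<in> hom C Q P \<Longrightarrow> h' \<in> hom C Q P \<Longrightarrow> p \<cdot> h = p \<cdot> h' \<Longrightarrow> q \<cdot> h = q \<cdot> h' \<Longrightarrow> h = h'"
  shows "is_pullback C f g p q"
proof -
  have src: "src C f = A" "src C g = D" "src C p = P" using assms(1-3) by (auto simp: hom_def)
  have "\<exists>!h. h \<in> hom C Q P \<and> p \<cdot> h = u \<and> q \<cdot> h = v"
    if "u \<in> hom C Q A" "v \<in> hom C Q D" "f \<cdot> u = g \<cdot> v" for Q u v
    using assms(6)[OF that] assms(7) by metis
  then show ?thesis unfolding is_pullback_def src
    using assms(3-5) homD[OF assms(1)] homD[OF assms(2)] by simp
qed

lemma productD:
  assumes "is_product C A B p q"
  shows "p \<in> hom C (src C p) A" "q \<in> hom C (src C p) B"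
  using assms by (auto simp: is_product_def)

lemma product_eqI:
  assumes "is_product C A B p q" "u \<in> hom C Q (src C p)" "v \<in> hom C Q (src C p)"
    "p \<cdot> u = p \<cdot> v" "q \<cdot> u = q \<cdot> v"
  shows "u = v"
proof -
  have "\<exists>!h. h \<in> hom C Q (src C p) \<and> p \<cdot> h = p \<cdot> u \<and> q \<cdot> h = q \<cdot> u"
    using assms(1,2) cmp_in_hom[OF assms(2)] unfolding is_product_def by blast
  then show ?thesis using assms by metis
qed

lemma product_pair:
  assumes "is_product C A B p q" "u \<in> hom C Q A" "v \<in> hom C Q B"
  shows "pair C p q u v \<in> hom C Q (src C p)" "p \<cdot> pair C p q u v = u" "q \<cdot> pair C p q u v = v"
proof -
  have "\<exists>!h. h \<in> hom C (src C u) (src C p) \<and> p \<cdot> h = u \<and> q \<cdot> h = v"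
    using assms(1,2,3) hom_src[OF assms(2)] unfolding is_product_def by blast
  from theI'[OF this] show "pair C p q u v \<in> hom C Q (src C p)"
    "p \<cdot> pair C p q u v = u" "q \<cdot> pair C p q u v = v"
    unfolding pair_def using hom_src[OF assms(2)] by simp_all
qed

lemma productI:
  assumes "p \<in> hom C P A" "q \<in> hom C P B"
    and "\<And>Q u v. u \<in> hom C Q A \<Longrightarrow> v \<in> hom C Q B \<Longrightarrow> \<exists>h \<in> hom C Q P. p \<cdot> h = u \<and> q \<cdot> h = v"
    and "\<And>Q h h'. h \<in> hom C Q P \<Longrightarrow> h' \<in> hom C Q P \<Longrightarrow> p \<cdot> h = p \<cdot> h' \<Longrightarrow> q \<cdot> h = q \<cdot> h' \<Longrightarrow> h = h'"
  shows "is_product C A B p q"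
proof -
  have src: "src C p = P" using assms(1) by (auto simp: hom_def)
  have "\<exists>!h. h \<in> hom C Q P \<and> p \<cdot> h = u \<and> q \<cdot> h = v"
    if "u \<in> hom C Q A" "v \<in> hom C Q B" for Q u v
    using assms(3)[OF that] assms(4) by metis
  then show ?thesis unfolding is_product_def src using assms(1,2) by simp
qed

lemma product_swap:
  assumes prod: "is_product C A B p q" shows "is_product C B A q p"
proof -
  note pq = productD[OF prod]
  show ?thesis
  proof (rule productI[OF pq(2,1)])
    fix Q u v assume u: "u \<in> hom C Q B" and v: "v \<in> hom C Q A"
    show "\<exists>h\<in>hom C Q (src C p). q \<cdot> h = u \<and> p \<cdot> h = v"
      using product_pair[OF prod v u] by blast
  next
    fix Q h h' assume "h \<in> hom C Q (src C p)" "h' \<in> hom C Q (src C p)" "q \<cdot> h = q \<cdot> h'" "p \<cdot> h = p \<cdot> h'"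
    then show "h = h'" using product_eqI[OF prod] by blast
  qed
qed

lemma cmp_pair:
  assumes "is_product C A B p q" "u \<in> hom C Q A" "v \<in> hom C Q B" "w \<in> hom C W Q"
  shows "pair C p q u v \<cdot> w = pair C p q (u \<cdot> w) (v \<cdot> w)"
proof (rule product_eqI[OF assms(1)])
  note uv = product_pair[OF assms(1-3)]
  note uvw = product_pair[OF assms(1) cmp_in_hom[OF assms(4,2)] cmp_in_hom[OF assms(4,3)]]
  note pq = productD[OF assms(1)]
  show "pair C p q u v \<cdot> w \<in> hom C W (src C p)" using cmp_in_hom assms(4) uv(1) by blast
  show "pair C p q (u \<cdot> w) (v \<cdot> w) \<in> hom C W (src C p)" by (rule uvw(1))
  show "p \<cdot> (pair C p q u v \<cdot> w) = p \<cdot> pair C p q (u \<cdot> w) (v \<cdot> w)"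
    using cmp_reassoc[OF uv(2) assms(4) uv(1) pq(1)] uvw(2) by simp
  show "q \<cdot> (pair C p q u v \<cdot> w) = q \<cdot> pair C p q (u \<cdot> w) (v \<cdot> w)"
    using cmp_reassoc[OF uv(3) assms(4) uv(1) pq(2)] uvw(3) by simp
qed

lemma map_pair_left:
  assumes "is_product C A B p q" "is_product C A' B p' q'" "a \<in> hom C A A'"
    "u \<in> hom C Q A" "v \<in> hom C Q B"
  shows "pair C p' q' (a \<cdot> p) q \<cdot> pair C p q u v = pair C p' q' (a \<cdot> u) v"
proof -
  note pq = productD[OF assms(1)] and uv = product_pair[OF assms(1,4,5)]
  show ?thesis
    using cmp_pair[OF assms(2) cmp_in_hom[OF pq(1) assms(3)] pq(2) uv(1)]
      cmp_assoc[OF uv(1) pq(1) assms(3)] uv(2,3) by simp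
qed

end

text \<open>The objects are \<open>0\<close>, \<open>1\<close>, \<open>2\<close>, each of them also the name of its own identity; the other
  morphisms are \<open>3 : 0 \<rightarrow> 2\<close> and \<open>4 : 1 \<rightarrow> 2\<close>.\<close>

definition cospan_shape :: "(nat, nat) cat" where
  "cospan_shape = \<lparr>ob = {0, 1, 2}, mor = {0, 1, 2, 3, 4},
     src = (\<lambda>u. if u = 3 then 0 else if u = 4 then 1 else u),
     tgt = (\<lambda>u. if u = 3 \<or> u = 4 then 2 else u),
     ide = (\<lambda>j. j), cmp = (\<lambda>v u. if v = 3 \<or> v = 4 then v else u)\<rparr>"

lemma category_cospan_shape: "category cospan_shape"
  by unfold_locales (auto simp: cospan_shape_def hom_def split: if_splits)

lemma finitely_complete_pullback:
  fixes C (structure)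
  assumes fc: "finitely_complete C" and f: "f \<in> hom C A B" and g: "g \<in> hom C D B"
  shows "\<exists>p q. is_pullback C f g p q"
proof -
  interpret category C using fc by (simp add: finitely_complete_def)
  define Fo where "Fo = (\<lambda>j::nat. if j = 0 then A else if j = 1 then D else B)"
  define Fm where "Fm = (\<lambda>u::nat. if u = 3 then f else if u = 4 then g else ide C (Fo u))"
  have obs: "A \<in> ob C" "B \<in> ob C" "D \<in> ob C" using f g hom_ob by blast+
  have "is_functor cospan_shape C Fo Fm"
    using f g obs ide_in_hom[OF obs(1)] ide_in_hom[OF obs(2)] ide_in_hom[OF obs(3)]
      cmp_ide_left[OF ide_in_hom[OF obs(1)]] cmp_ide_left[OF ide_in_hom[OF obs(2)]]
      cmp_ide_left[OF ide_in_hom[OF obs(3)]] cmp_ide_left[OF f] cmp_ide_left[OF g]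
      cmp_ide_right[OF f] cmp_ide_right[OF g]
    by (simp add: is_functor_def cospan_shape_def Fo_def Fm_def)
  then obtain L \<pi> where lim: "is_limit cospan_shape C Fo Fm L \<pi>"
    using fc category_cospan_shape
    unfolding finitely_complete_def by (force simp: cospan_shape_def)
  have cone_iff: "is_cone cospan_shape C Fo Fm L' \<rho> \<longleftrightarrow> L' \<in> ob C \<and> \<rho> 0 \<in> hom C L' A \<and>
      \<rho> 1 \<in> hom C L' D \<and> \<rho> 2 \<in> hom C L' B \<and> f \<cdot> \<rho> 0 = \<rho> 2 \<and> g \<cdot> \<rho> 1 = \<rho> 2" for L' \<rho>
    using cmp_ide_left by (auto simp: is_cone_def cospan_shape_def Fo_def Fm_def)
  have c: "\<pi> 0 \<in> hom C L A" "\<pi> 1 \<in> hom C L D" "f \<cdot> \<pi> 0 = \<pi> 2" "g \<cdot> \<pi> 1 = \<pi> 2"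
    using lim unfolding is_limit_def cone_iff by blast+
  have univ: "\<exists>!h. h \<in> hom C L' L \<and> \<pi> 0 \<cdot> h = \<rho> 0 \<and> \<pi> 1 \<cdot> h = \<rho> 1 \<and> \<pi> 2 \<cdot> h = \<rho> 2"
    if "is_cone cospan_shape C Fo Fm L' \<rho>" for L' \<rho>
    using lim that unfolding is_limit_def by (simp add: cospan_shape_def)
  have "is_pullback C f g (\<pi> 0) (\<pi> 1)"
  proof (rule pullbackI[OF f g c(1,2)])
    show "f \<cdot> \<pi> 0 = g \<cdot> \<pi> 1" using c by simp
  next
    fix Q u v assume uv: "u \<in> hom C Q A" "v \<in> hom C Q D" "f \<cdot> u = g \<cdot> v"
    define \<rho> where "\<rho> = (\<lambda>j::nat. if j = 0 then u else if j = 1 then v else f \<cdot> u)"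
    have "is_cone cospan_shape C Fo Fm Q \<rho>"
      unfolding cone_iff using uv hom_ob cmp_in_hom[OF uv(1) f] by (auto simp: \<rho>_def)
    from univ[OF this] show "\<exists>h\<in>hom C Q L. \<pi> 0 \<cdot> h = u \<and> \<pi> 1 \<cdot> h = v"
      by (auto simp: \<rho>_def)
  next
    fix Q h h' assume h: "h \<in> hom C Q L" "h' \<in> hom C Q L" "\<pi> 0 \<cdot> h = \<pi> 0 \<cdot> h'" "\<pi> 1 \<cdot> h = \<pi> 1 \<cdot> h'"
    define \<rho> where "\<rho> = (\<lambda>j. \<pi> j \<cdot> h)"
    have "f \<cdot> (\<pi> 0 \<cdot> h) = \<pi> 2 \<cdot> h" "g \<cdot> (\<pi> 1 \<cdot> h) = \<pi> 2 \<cdot> h" "f \<cdot> (\<pi> 0 \<cdot> h') = \<pi> 2 \<cdot> h'"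
      using cmp_reassoc[OF c(3) h(1) c(1) f] cmp_reassoc[OF c(4) h(1) c(2) g]
        cmp_reassoc[OF c(3) h(2) c(1) f] by simp_all
    moreover from this have "is_cone cospan_shape C Fo Fm Q \<rho>"
      unfolding cone_iff \<rho>_def
      using hom_ob[OF h(1)] cmp_in_hom[OF h(1) c(1)] cmp_in_hom[OF h(1) c(2)]
        cmp_in_hom[OF cmp_in_hom[OF h(1) c(1)] f] by simp
    ultimately show "h = h'" using univ[of Q \<rho>] h unfolding \<rho>_def by auto
  qed
  then show ?thesis by blast
qed


section \<open>Zero morphisms, kernels and Huq-commutativity\<close>

notation zero_mor ("\<zero>\<index>")

locale pointed_category = category C for C :: "('o, 'm) cat" (structure) +
  assumes ex_zero_object: "\<exists>Z. zero_object C Z"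
begin

lemma to_zero_ex: "zero_object C Z \<Longrightarrow> A \<in> ob C \<Longrightarrow> \<exists>u. u \<in> hom C A Z"
  unfolding zero_object_def by (metis (no_types))

lemma from_zero_ex: "zero_object C Z \<Longrightarrow> A \<in> ob C \<Longrightarrow> \<exists>u. u \<in> hom C Z A"
  unfolding zero_object_def by (metis (no_types))

lemma to_zero_eq: "zero_object C Z \<Longrightarrow> u \<in> hom C A Z \<Longrightarrow> v \<in> hom C A Z \<Longrightarrow> u = v"
  using hom_ob[of u A Z] unfolding zero_object_def by (metis (no_types))

lemma from_zero_eq: "zero_object C Z \<Longrightarrow> u \<in> hom C Z A \<Longrightarrow> v \<in> hom C Z A \<Longrightarrow> u = v"
  using hom_ob[of u Z A] unfolding zero_object_def by (metis (no_types))

text \<open>Composites through different zero objects agree, because the comparison between the two zero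
  objects is compatible with all morphisms into and out of them.\<close>

lemma zero_mor_eqI:
  assumes Z: "zero_object C Z" and u: "u \<in> hom C A Z" and v: "v \<in> hom C Z B"
  shows "\<zero> A B = v \<cdot> u"
proof -
  have uniq: "v' \<cdot> u' = v \<cdot> u"
    if Z': "zero_object C Z'" and u': "u' \<in> hom C A Z'" and v': "v' \<in> hom C Z' B" for Z' u' v'
  proof -
    obtain w where w: "w \<in> hom C Z' Z" using to_zero_ex[OF Z] hom_ob[OF u'] by blast
    have "w \<cdot> u' = u" by (rule to_zero_eq[OF Z cmp_in_hom[OF u' w] u])
    moreover have "v \<cdot> w = v'" by (rule from_zero_eq[OF Z' cmp_in_hom[OF w v] v'])
    ultimately show ?thesis using cmp_assoc[OF u' w v] by simp
  qed
  show ?thesis unfolding zero_mor_def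
  proof (rule the_equality)
    show "\<exists>Z' u' v'. zero_object C Z' \<and> u' \<in> hom C A Z' \<and> v' \<in> hom C Z' B \<and> v \<cdot> u = v' \<cdot> u'"
      using assms by blast
  next
    fix f assume "\<exists>Z' u' v'. zero_object C Z' \<and> u' \<in> hom C A Z' \<and> v' \<in> hom C Z' B \<and> f = v' \<cdot> u'"
    then show "f = v \<cdot> u" using uniq by (elim exE conjE) simp
  qed
qed

lemma zero_mor_factor:
  assumes "A \<in> ob C" "B \<in> ob C"
  obtains Z u v where "zero_object C Z" "u \<in> hom C A Z" "v \<in> hom C Z B" "\<zero> A B = v \<cdot> u"
proof -
  obtain Z where Z: "zero_object C Z" using ex_zero_object by blast
  obtain u v where u: "u \<in> hom C A Z" and v: "v \<in> hom C Z B"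
    using to_zero_ex[OF Z] from_zero_ex[OF Z] assms by blast
  show ?thesis by (rule that[OF Z u v zero_mor_eqI[OF Z u v]])
qed

lemma zero_in_hom: "A \<in> ob C \<Longrightarrow> B \<in> ob C \<Longrightarrow> \<zero> A B \<in> hom C A B"
  using zero_mor_factor cmp_in_hom by metis

lemma zero_right:
  assumes "A \<in> ob C" "g \<in> hom C B D" shows "g \<cdot> \<zero> A B = \<zero> A D"
proof -
  obtain Z u v where z: "zero_object C Z" "u \<in> hom C A Z" "v \<in> hom C Z B" "\<zero> A B = v \<cdot> u"
    using zero_mor_factor assms(1) hom_ob[OF assms(2)] by blast
  show ?thesis
    using zero_mor_eqI[OF z(1,2) cmp_in_hom[OF z(3) assms(2)]] cmp_assoc[OF z(2,3) assms(2)] z(4)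
    by simp
qed

lemma zero_left:
  assumes "D \<in> ob C" "f \<in> hom C A B" shows "\<zero> B D \<cdot> f = \<zero> A D"
proof -
  obtain Z u v where z: "zero_object C Z" "u \<in> hom C B Z" "v \<in> hom C Z D" "\<zero> B D = v \<cdot> u"
    using zero_mor_factor assms(1) hom_ob[OF assms(2)] by blast
  show ?thesis
    using zero_mor_eqI[OF z(1) cmp_in_hom[OF assms(2) z(2)] z(3)] cmp_assoc[OF assms(2) z(2,3)] z(4)
    by simp
qed

lemma kernelD:
  assumes "is_kernel C f k" "f \<in> hom C A B"
  shows "k \<in> hom C (src C k) A" "f \<cdot> k = \<zero> (src C k) B"
  using assms by (auto simp: is_kernel_def hom_def)

lemma kernel_ex:
  assumes "is_kernel C f k" "f \<in> hom C A B" "u \<in> hom C Q A" "f \<cdot> u = \<zero> Q B"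
  shows "\<exists>h \<in> hom C Q (src C k). k \<cdot> h = u"
  using assms unfolding is_kernel_def by (metis hom_src hom_tgt)

lemma kernel_eqI:
  assumes k: "is_kernel C f k" "u \<in> hom C Q (src C k)" "v \<in> hom C Q (src C k)" "k \<cdot> u = k \<cdot> v"
  shows "u = v"
proof -
  have f: "f \<in> hom C (src C f) (tgt C f)" using k(1) by (auto simp: is_kernel_def hom_def)
  note kD = kernelD[OF k(1) f]
  have "f \<cdot> (k \<cdot> u) = \<zero> Q (tgt C f)"
    using cmp_reassoc[OF kD(2) k(2) kD(1) f] zero_left[OF _ k(2)] hom_ob[OF f] by simp
  moreover have "k \<cdot> u \<in> hom C Q (src C f)" using cmp_in_hom k(2) kD(1) by blast
  ultimately have "\<exists>!h. h \<in> hom C Q (src C k) \<and> k \<cdot> h = k \<cdot> u"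
    using k(1) unfolding is_kernel_def by blast
  then show ?thesis using k by metis
qed

text \<open>Huq-commutativity can be tested on any one product, because the comparison between two
  products carries the injections of one to those of the other.\<close>

lemma huq_commute_iff:
  assumes \<alpha>: "\<alpha> \<in> hom C A D" and \<gamma>: "\<gamma> \<in> hom C B D" and prod: "is_product C A B p q"
  shows "huq_commute C \<alpha> \<gamma> \<longleftrightarrow> (\<exists>\<phi>\<in>hom C (src C p) D.
    \<phi> \<cdot> pair C p q (ide C A) (\<zero> A B) = \<alpha> \<and> \<phi> \<cdot> pair C p q (\<zero> B A) (ide C B) = \<gamma>)"
    (is "_ \<longleftrightarrow> ?R")
proof
  assume ?R
  then show "huq_commute C \<alpha> \<gamma>"
    unfolding huq_commute_def using homD[OF \<alpha>] homD[OF \<gamma>] prod by auto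
next
  assume "huq_commute C \<alpha> \<gamma>"
  then obtain p' q' \<phi> where prod': "is_product C A B p' q'" and \<phi>: "\<phi> \<in> hom C (src C p') D"
    and \<phi>\<alpha>: "\<phi> \<cdot> pair C p' q' (ide C A) (\<zero> A B) = \<alpha>"
    and \<phi>\<gamma>: "\<phi> \<cdot> pair C p' q' (\<zero> B A) (ide C B) = \<gamma>"
    unfolding huq_commute_def using homD[OF \<alpha>] homD[OF \<gamma>] by auto
  define h where "h = pair C p' q' p q"
  note pq = productD[OF prod]
  note h = product_pair[OF prod' pq, folded h_def]
  have h_pair: "h \<cdot> pair C p q u v = pair C p' q' u v"
    if u: "u \<in> hom C Q A" and v: "v \<in> hom C Q B" for Q u v
    using cmp_pair[OF prod' pq product_pair(1)[OF prod u v]] product_pair(2,3)[OF prod u v]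
    by (simp add: h_def)
  have obs: "A \<in> ob C" "B \<in> ob C" using hom_ob \<alpha> \<gamma> by blast+
  note hs = ide_in_hom[OF obs(1)] zero_in_hom[OF obs] zero_in_hom[OF obs(2,1)] ide_in_hom[OF obs(2)]
  have "(\<phi> \<cdot> h) \<cdot> pair C p q (ide C A) (\<zero> A B) = \<alpha>"
    using cmp_assoc[OF product_pair(1)[OF prod hs(1,2)] h(1) \<phi>] h_pair[OF hs(1,2)] \<phi>\<alpha> by simp
  moreover have "(\<phi> \<cdot> h) \<cdot> pair C p q (\<zero> B A) (ide C B) = \<gamma>"
    using cmp_assoc[OF product_pair(1)[OF prod hs(3,4)] h(1) \<phi>] h_pair[OF hs(3,4)] \<phi>\<gamma> by simp
  ultimately show ?R using cmp_in_hom[OF h(1) \<phi>] by blast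
qed

lemma huq_commute_sym:
  assumes "huq_commute C \<alpha> \<gamma>" shows "huq_commute C \<gamma> \<alpha>"
proof -
  let ?A = "src C \<alpha>" and ?B = "src C \<gamma>"
  obtain p q \<phi> where *: "\<alpha> \<in> mor C" "\<gamma> \<in> mor C" "tgt C \<alpha> = tgt C \<gamma>"
    and prod: "is_product C ?A ?B p q" and \<phi>: "\<phi> \<in> hom C (src C p) (tgt C \<alpha>)"
    "\<phi> \<cdot> pair C p q (ide C ?A) (\<zero> ?A ?B) = \<alpha>" "\<phi> \<cdot> pair C p q (\<zero> ?B ?A) (ide C ?B) = \<gamma>"
    using assms unfolding huq_commute_def by blast
  have obs: "?A \<in> ob C" "?B \<in> ob C" using * src_in_ob by blast+
  have src: "src C q = src C p" using prod by (auto simp: is_product_def hom_def)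
  have swap: "pair C q p v u = pair C p q u v" if "u \<in> hom C Q ?A" "v \<in> hom C Q ?B" for Q u v
    using that unfolding pair_def by (simp add: conj_commute hom_def src)
  note s = swap[OF ide_in_hom[OF obs(1)] zero_in_hom[OF obs]]
    swap[OF zero_in_hom[OF obs(2,1)] ide_in_hom[OF obs(2)]]
  show ?thesis
    using huq_commute_iff[OF mor_in_hom[OF *(2)] _ product_swap[OF prod]] mor_in_hom[OF *(1)] \<phi>
    unfolding *(3) src s by blast
qed

lemma huq_commute_postcompose:
  assumes huq: "huq_commute C \<alpha> \<gamma>" and \<alpha>: "\<alpha> \<in> hom C A D" and \<gamma>: "\<gamma> \<in> hom C B D"
    and d: "d \<in> hom C D E"
  shows "huq_commute C (d \<cdot> \<alpha>) (d \<cdot> \<gamma>)"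
proof -
  obtain p q where prod: "is_product C A B p q"
    using huq hom_src[OF \<alpha>] hom_src[OF \<gamma>] unfolding huq_commute_def by auto
  obtain \<phi> where \<phi>: "\<phi> \<in> hom C (src C p) D" "\<phi> \<cdot> pair C p q (ide C A) (\<zero> A B) = \<alpha>"
    "\<phi> \<cdot> pair C p q (\<zero> B A) (ide C B) = \<gamma>"
    using huq huq_commute_iff[OF \<alpha> \<gamma> prod] by blast
  have obs: "A \<in> ob C" "B \<in> ob C" using hom_ob \<alpha> \<gamma> by blast+
  note hs = ide_in_hom[OF obs(1)] zero_in_hom[OF obs] zero_in_hom[OF obs(2,1)] ide_in_hom[OF obs(2)]
  have "(d \<cdot> \<phi>) \<cdot> pair C p q (ide C A) (\<zero> A B) = d \<cdot> \<alpha>"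
    using cmp_assoc[OF product_pair(1)[OF prod hs(1,2)] \<phi>(1) d] \<phi>(2) by simp
  moreover have "(d \<cdot> \<phi>) \<cdot> pair C p q (\<zero> B A) (ide C B) = d \<cdot> \<gamma>"
    using cmp_assoc[OF product_pair(1)[OF prod hs(3,4)] \<phi>(1) d] \<phi>(3) by simp
  ultimately show ?thesis
    using huq_commute_iff[OF cmp_in_hom[OF \<alpha> d] cmp_in_hom[OF \<gamma> d] prod] cmp_in_hom[OF \<phi>(1) d]
    by blast
qed

end

locale pointed_pullback_category = pointed_category +
  assumes ex_pullback: "f \<in> hom C A B \<Longrightarrow> g \<in> hom C D B \<Longrightarrow> \<exists>p q. is_pullback C f g p q"
begin

text \<open>Over a zero object every square commutes, so the two universal properties coincide. Binary
  products and the weak Mal'tsev property of their injections are thus special cases of facts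
  about pullbacks.\<close>

lemma product_iff_pullback_over_zero:
  assumes Z: "zero_object C Z" and f: "f \<in> hom C A Z" and g: "g \<in> hom C B Z"
  shows "is_product C A B p q \<longleftrightarrow> is_pullback C f g p q"
proof -
  have eq: "f \<cdot> u = g \<cdot> v" if "u \<in> hom C Q A" "v \<in> hom C Q B" for Q u v
    by (rule to_zero_eq[OF Z cmp_in_hom[OF that(1) f] cmp_in_hom[OF that(2) g]])
  note src = hom_src[OF f] hom_src[OF g]
  show ?thesis
  proof
    assume prod: "is_product C A B p q"
    note pq = productD[OF prod]
    show "is_pullback C f g p q"
      by (rule pullbackI[OF f g pq eq[OF pq]])
        (use product_pair[OF prod] product_eqI[OF prod] in blast)+
  next
    assume pb: "is_pullback C f g p q"
    note pq = pullbackD(2,3)[OF pb f, unfolded src]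
    show "is_product C A B p q"
      by (rule productI[OF pq])
        (use pullback_pair[OF pb f g _ _ eq] pullback_eqI[OF pb] in blast)+
  qed
qed

lemma ex_product:
  assumes "A \<in> ob C" "B \<in> ob C" shows "\<exists>p q. is_product C A B p q"
proof -
  obtain Z f g where "zero_object C Z" "f \<in> hom C A Z" "g \<in> hom C B Z"
    using ex_zero_object to_zero_ex assms by metis
  then show ?thesis using product_iff_pullback_over_zero ex_pullback by metis
qed

text \<open>The kernel is the pullback along the morphism from a zero object.\<close>

lemma ex_kernel:
  assumes f: "f \<in> hom C A B" shows "\<exists>k. is_kernel C f k"
proof -
  have obs: "A \<in> ob C" "B \<in> ob C" using hom_ob[OF f] by blast+
  obtain Z where Z: "zero_object C Z" using ex_zero_object by blast
  obtain z where z: "z \<in> hom C Z B" using from_zero_ex[OF Z] obs by blast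
  obtain k t where pb: "is_pullback C f z k t" using ex_pullback[OF f z] by blast
  have kt: "k \<in> hom C (src C k) A" "t \<in> hom C (src C k) Z" "f \<cdot> k = z \<cdot> t"
    using pullbackD[OF pb f] hom_src[OF z] by auto
  have zz: "z \<cdot> w = \<zero> Q B" if "w \<in> hom C Q Z" for w Q
    using zero_mor_eqI[OF Z that z] by simp
  have "\<exists>!h. h \<in> hom C Q (src C k) \<and> k \<cdot> h = u"
    if u: "u \<in> hom C Q A" and fu: "f \<cdot> u = \<zero> Q B" for Q u
  proof -
    have Q: "Q \<in> ob C" using hom_ob[OF u] by blast
    obtain w where w: "w \<in> hom C Q Z" using to_zero_ex[OF Z Q] by blast
    obtain h where "h \<in> hom C Q (src C k)" "k \<cdot> h = u"
      using pullback_ex[OF pb f z u w] fu zz[OF w] by auto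
    moreover have "h' = h''"
      if "h' \<in> hom C Q (src C k)" "h'' \<in> hom C Q (src C k)" "k \<cdot> h' = k \<cdot> h''" for h' h''
    proof (rule pullback_eqI[OF pb that])
      show "t \<cdot> h' = t \<cdot> h''"
        by (rule to_zero_eq[OF Z cmp_in_hom[OF that(1) kt(2)] cmp_in_hom[OF that(2) kt(2)]])
    qed
    ultimately show ?thesis by metis
  qed
  then have "is_kernel C f k" unfolding is_kernel_def
    using homD[OF f] kt zz[OF kt(2)] by simp
  then show ?thesis by blast
qed

lemma is_kernel_ker: "f \<in> hom C A B \<Longrightarrow> is_kernel C f (ker C f)"
  using ex_kernel unfolding ker_def by (metis someI_ex)

text \<open>The connecting morphism of the composites is \<open>\<phi> (a \<times> b)\<close>.\<close>

lemma huq_commute_precompose: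
  assumes huq: "huq_commute C \<alpha> \<gamma>" and \<alpha>: "\<alpha> \<in> hom C A D" and \<gamma>: "\<gamma> \<in> hom C B D"
    and a: "a \<in> hom C A' A" and b: "b \<in> hom C B' B"
  shows "huq_commute C (\<alpha> \<cdot> a) (\<gamma> \<cdot> b)"
proof -
  have obs: "A \<in> ob C" "B \<in> ob C" "A' \<in> ob C" "B' \<in> ob C" using hom_ob a b by blast+
  obtain p q where prod: "is_product C A B p q" using ex_product obs by blast
  obtain p' q' where prod': "is_product C A' B' p' q'" using ex_product obs by blast
  obtain \<phi> where \<phi>: "\<phi> \<in> hom C (src C p) D" "\<phi> \<cdot> pair C p q (ide C A) (\<zero> A B) = \<alpha>"
    "\<phi> \<cdot> pair C p q (\<zero> B A) (ide C B) = \<gamma>"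
    using huq huq_commute_iff[OF \<alpha> \<gamma> prod] by blast
  note pq' = productD[OF prod']
  note ap = cmp_in_hom[OF pq'(1) a] and bq = cmp_in_hom[OF pq'(2) b]
  define ab where "ab = pair C p q (a \<cdot> p') (b \<cdot> q')"
  note ab = product_pair(1)[OF prod ap bq, folded ab_def]
  have hs: "ide C A \<in> hom C A A" "\<zero> A B \<in> hom C A B" "\<zero> B A \<in> hom C B A" "ide C B \<in> hom C B B"
    "ide C A' \<in> hom C A' A'" "\<zero> A' B' \<in> hom C A' B'" "\<zero> B' A' \<in> hom C B' A'" "ide C B' \<in> hom C B' B'"
    using obs ide_in_hom zero_in_hom by blast+
  have ab_pair: "ab \<cdot> pair C p' q' u v = pair C p q (a \<cdot> u) (b \<cdot> v)"
    if u: "u \<in> hom C Q A'" and v: "v \<in> hom C Q B'" for Q u v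
    using cmp_pair[OF prod ap bq product_pair(1)[OF prod' u v]]
      cmp_assoc[OF product_pair(1)[OF prod' u v] pq'(1) a]
      cmp_assoc[OF product_pair(1)[OF prod' u v] pq'(2) b] product_pair(2,3)[OF prod' u v]
    by (simp add: ab_def)
  have "ab \<cdot> pair C p' q' (ide C A') (\<zero> A' B') = pair C p q (ide C A) (\<zero> A B) \<cdot> a"
    using ab_pair[OF hs(5,6)] cmp_pair[OF prod hs(1,2) a] cmp_ide_left[OF a] cmp_ide_right[OF a]
      zero_left[OF obs(2) a] zero_right[OF obs(3) b] by simp
  then have 1: "(\<phi> \<cdot> ab) \<cdot> pair C p' q' (ide C A') (\<zero> A' B') = \<alpha> \<cdot> a"
    using cmp_assoc[OF product_pair(1)[OF prod' hs(5,6)] ab \<phi>(1)]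
      cmp_reassoc[OF \<phi>(2) a product_pair(1)[OF prod hs(1,2)] \<phi>(1)] by simp
  have "ab \<cdot> pair C p' q' (\<zero> B' A') (ide C B') = pair C p q (\<zero> B A) (ide C B) \<cdot> b"
    using ab_pair[OF hs(7,8)] cmp_pair[OF prod hs(3,4) b] cmp_ide_left[OF b] cmp_ide_right[OF b]
      zero_left[OF obs(1) b] zero_right[OF obs(4) a] by simp
  then have 2: "(\<phi> \<cdot> ab) \<cdot> pair C p' q' (\<zero> B' A') (ide C B') = \<gamma> \<cdot> b"
    using cmp_assoc[OF product_pair(1)[OF prod' hs(7,8)] ab \<phi>(1)]
      cmp_reassoc[OF \<phi>(3) b product_pair(1)[OF prod hs(3,4)] \<phi>(1)] by simp
  show ?thesis
    using 1 2 huq_commute_iff[OF cmp_in_hom[OF a \<alpha>] cmp_in_hom[OF b \<gamma>] prod']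
      cmp_in_hom[OF ab \<phi>(1)] by blast
qed

text \<open>The equation \<open>\<langle>d, c\<rangle> u = \<langle>0, 1\<rangle> v\<close> says exactly that \<open>d u = 0\<close> and \<open>v = c u\<close>.\<close>

lemma zero_class_iff:
  assumes d: "d \<in> hom C R X" and c: "c \<in> hom C R Y"
  shows "is_zero_class C d c i \<longleftrightarrow> (\<exists>k. is_kernel C d k \<and> i = c \<cdot> k)"
proof -
  have obs: "R \<in> ob C" "X \<in> ob C" "Y \<in> ob C" using hom_ob d c by blast+
  note z = zero_in_hom[OF obs(3,2)] and one = ide_in_hom[OF obs(3)]
  have pb_iff: "is_pullback C (pair C p q d c) (pair C p q (\<zero> Y X) (ide C Y)) k i \<longleftrightarrow>
      is_kernel C d k \<and> i = c \<cdot> k" (is "is_pullback C ?m ?n k i \<longleftrightarrow> _")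
    if prod: "is_product C X Y p q" for p q k i
  proof -
    note m = product_pair[OF prod d c] and n = product_pair[OF prod z one]
    note pq = productD[OF prod]
    have eq_iff: "?m \<cdot> u = ?n \<cdot> v \<longleftrightarrow> d \<cdot> u = \<zero> Q X \<and> v = c \<cdot> u"
      if u: "u \<in> hom C Q R" and v: "v \<in> hom C Q Y" for Q u v
    proof -
      have 1: "?m \<cdot> u = pair C p q (d \<cdot> u) (c \<cdot> u)" by (rule cmp_pair[OF prod d c u])
      have 2: "?n \<cdot> v = pair C p q (\<zero> Q X) v"
        using cmp_pair[OF prod z one v] zero_left[OF obs(2) v] cmp_ide_left[OF v] by simp
      have Q: "Q \<in> ob C" using hom_ob u by blast
      note P = product_pair[OF prod cmp_in_hom[OF u d] cmp_in_hom[OF u c]]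
        product_pair[OF prod zero_in_hom[OF Q obs(2)] v]
      show ?thesis unfolding 1 2 using P by metis
    qed
    show ?thesis
    proof
      assume pb: "is_pullback C ?m ?n k i"
      have k: "k \<in> hom C (src C k) R" "i \<in> hom C (src C k) Y" "?m \<cdot> k = ?n \<cdot> i"
        using pullbackD[OF pb m(1)] hom_src[OF n(1)] by auto
      then have dk: "d \<cdot> k = \<zero> (src C k) X" "i = c \<cdot> k" using eq_iff by blast+
      have "\<exists>!h. h \<in> hom C Q (src C k) \<and> k \<cdot> h = u"
        if u: "u \<in> hom C Q R" and du: "d \<cdot> u = \<zero> Q X" for Q u
      proof -
        note cu = cmp_in_hom[OF u c]
        have "?m \<cdot> u = ?n \<cdot> (c \<cdot> u)" using eq_iff[OF u cu] du by simp
        from pullback_ex[OF pb m(1) n(1) u cu this]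
        obtain h where "h \<in> hom C Q (src C k)" "k \<cdot> h = u" by blast
        moreover have "h' = h''"
          if "h' \<in> hom C Q (src C k)" "h'' \<in> hom C Q (src C k)" "k \<cdot> h' = k \<cdot> h''" for h' h''
        proof (rule pullback_eqI[OF pb that])
          show "i \<cdot> h' = i \<cdot> h''"
            using cmp_assoc[OF that(1) k(1) c] cmp_assoc[OF that(2) k(1) c] that(3) dk(2) by simp
        qed
        ultimately show ?thesis by metis
      qed
      then show "is_kernel C d k \<and> i = c \<cdot> k"
        unfolding is_kernel_def using homD[OF d] k dk by auto
    next
      assume asm: "is_kernel C d k \<and> i = c \<cdot> k"
      then have ker: "is_kernel C d k" and i: "i = c \<cdot> k" by blast+
      note k = kernelD[OF ker d]
      have ih: "i \<in> hom C (src C k) Y" using cmp_in_hom k(1) c i by blast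
      show "is_pullback C ?m ?n k i"
      proof (rule pullbackI[OF m(1) n(1) k(1) ih])
        show "?m \<cdot> k = ?n \<cdot> i" using eq_iff[OF k(1) ih] k(2) i by blast
      next
        fix Q u v assume u: "u \<in> hom C Q R" and v: "v \<in> hom C Q Y" and "?m \<cdot> u = ?n \<cdot> v"
        then have *: "d \<cdot> u = \<zero> Q X" "v = c \<cdot> u" using eq_iff by blast+
        obtain h where h: "h \<in> hom C Q (src C k)" "k \<cdot> h = u"
          using kernel_ex[OF ker d u *(1)] by blast
        then show "\<exists>h\<in>hom C Q (src C k). k \<cdot> h = u \<and> i \<cdot> h = v"
          using cmp_assoc[OF h(1) k(1) c] i * by auto
      next
        fix Q h h' assume "h \<in> hom C Q (src C k)" "h' \<in> hom C Q (src C k)" "k \<cdot> h = k \<cdot> h'"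
        then show "h = h'" using kernel_eqI[OF ker] by blast
      qed
    qed
  qed
  obtain p q where "is_product C X Y p q" using ex_product obs by blast
  then show ?thesis
    unfolding is_zero_class_def Let_def hom_tgt[OF d] hom_tgt[OF c] using pb_iff by blast
qed

end


section \<open>Commuting left split spans\<close>

context category
begin

lemma pointD:
  assumes "is_point C B (f, r)"
  shows "f \<in> hom C (src C f) B" "r \<in> hom C B (src C f)" "f \<cdot> r = ide C B"
  using assms by (auto simp: is_point_def)

lemma left_split_spanD:
  assumes "left_split_span C B D f \<alpha> r"
  shows "is_point C B (f, r)" "\<alpha> \<in> hom C (src C f) D"
  using assms by (auto simp: left_split_span_def is_point_def)

lemma e1_props:
  assumes f: "is_point C B (f, r)" and g: "is_point C B (g, s)" and pb: "is_pullback C f g p q"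
  shows "e1 C p q f s \<in> hom C (src C f) (src C p)" "p \<cdot> e1 C p q f s = ide C (src C f)"
    "q \<cdot> e1 C p q f s = s \<cdot> f"
proof -
  note f = pointD[OF f] and g = pointD[OF g]
  have 1: "ide C (src C f) \<in> hom C (src C f) (src C f)" using ide_in_hom hom_ob f by blast
  have "g \<cdot> (s \<cdot> f) = f" using cmp_reassoc[OF g(3) f(1) g(2,1)] cmp_ide_left[OF f(1)] by simp
  then have "f \<cdot> ide C (src C f) = g \<cdot> (s \<cdot> f)" using cmp_ide_right[OF f(1)] by simp
  from pullback_pair[OF pb f(1) g(1) 1 cmp_in_hom[OF f(1) g(2)] this]
  show "e1 C p q f s \<in> hom C (src C f) (src C p)" "p \<cdot> e1 C p q f s = ide C (src C f)"
    "q \<cdot> e1 C p q f s = s \<cdot> f" unfolding e1_def by blast+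
qed

lemma e2_props:
  assumes f: "is_point C B (f, r)" and g: "is_point C B (g, s)" and pb: "is_pullback C f g p q"
  shows "e2 C p q g r \<in> hom C (src C g) (src C p)" "p \<cdot> e2 C p q g r = r \<cdot> g"
    "q \<cdot> e2 C p q g r = ide C (src C g)"
proof -
  note f = pointD[OF f] and g = pointD[OF g]
  have 1: "ide C (src C g) \<in> hom C (src C g) (src C g)" using ide_in_hom hom_ob g by blast
  have "f \<cdot> (r \<cdot> g) = g" using cmp_reassoc[OF f(3) g(1) f(2,1)] cmp_ide_left[OF g(1)] by simp
  then have "f \<cdot> (r \<cdot> g) = g \<cdot> ide C (src C g)" using cmp_ide_right[OF g(1)] by simp
  from pullback_pair[OF pb f(1) g(1) cmp_in_hom[OF g(1) f(2)] 1 this]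
  show "e2 C p q g r \<in> hom C (src C g) (src C p)" "p \<cdot> e2 C p q g r = r \<cdot> g"
    "q \<cdot> e2 C p q g r = ide C (src C g)" unfolding e2_def by blast+
qed

text \<open>As for products, the comparison of two pullbacks preserves \<open>e1\<close> and \<open>e2\<close>, so any one pullback
  decides commutativity.\<close>

lemma left_split_commute_iff:
  assumes f: "is_point C B (f, r)" and g: "is_point C B (g, s)" and pb: "is_pullback C f g p q"
    and \<alpha>: "\<alpha> \<in> hom C (src C f) D" and \<gamma>: "\<gamma> \<in> hom C (src C g) D"
  shows "left_split_commute C f \<alpha> r g \<gamma> s \<longleftrightarrow>
    (\<exists>\<phi>\<in>hom C (src C p) D. \<phi> \<cdot> e1 C p q f s = \<alpha> \<and> \<phi> \<cdot> e2 C p q g r = \<gamma>)" (is "_ \<longleftrightarrow> ?R")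
proof
  assume ?R
  then show "left_split_commute C f \<alpha> r g \<gamma> s"
    unfolding left_split_commute_def using pb hom_tgt[OF \<alpha>] by blast
next
  assume "left_split_commute C f \<alpha> r g \<gamma> s"
  then obtain p' q' \<phi> where pb': "is_pullback C f g p' q'" and \<phi>: "\<phi> \<in> hom C (src C p') D"
    "\<phi> \<cdot> e1 C p' q' f s = \<alpha>" "\<phi> \<cdot> e2 C p' q' g r = \<gamma>"
    unfolding left_split_commute_def using hom_tgt[OF \<alpha>] by auto
  note fh = pointD[OF f] and gh = pointD[OF g]
  note pq = pullbackD[OF pb fh(1)] and pq' = pullbackD[OF pb' fh(1)]
  obtain h where h: "h \<in> hom C (src C p) (src C p')" "p' \<cdot> h = p" "q' \<cdot> h = q"
    using pullback_ex[OF pb' fh(1) gh(1) pq(2,3,4)] by blast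
  have carry: "h \<cdot> w = w'"
    if w: "w \<in> hom C Q (src C p)" and w': "w' \<in> hom C Q (src C p')"
      and "p \<cdot> w = p' \<cdot> w'" "q \<cdot> w = q' \<cdot> w'" for w w' Q
    using pullback_eqI[OF pb' cmp_in_hom[OF w h(1)] w'] that(3,4)
      cmp_reassoc[OF h(2) w h(1) pq'(2)] cmp_reassoc[OF h(3) w h(1) pq'(3)] by simp
  note i1 = e1_props[OF f g pb] and i2 = e2_props[OF f g pb]
  note j1 = e1_props[OF f g pb'] and j2 = e2_props[OF f g pb']
  have "h \<cdot> e1 C p q f s = e1 C p' q' f s" using carry[OF i1(1) j1(1)] i1 j1 by simp
  moreover have "h \<cdot> e2 C p q g r = e2 C p' q' g r" using carry[OF i2(1) j2(1)] i2 j2 by simp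
  ultimately have "(\<phi> \<cdot> h) \<cdot> e1 C p q f s = \<alpha>" "(\<phi> \<cdot> h) \<cdot> e2 C p q g r = \<gamma>"
    using cmp_assoc[OF i1(1) h(1) \<phi>(1)] cmp_assoc[OF i2(1) h(1) \<phi>(1)] \<phi> by simp_all
  then show ?R using cmp_in_hom[OF h(1) \<phi>(1)] by blast
qed

end

context pointed_pullback_category
begin

lemma left_split_commute_postcompose:
  assumes comm: "left_split_commute C f \<alpha> r g \<gamma> s"
    and f: "is_point C B (f, r)" and g: "is_point C B (g, s)"
    and \<alpha>: "\<alpha> \<in> hom C (src C f) D" and \<gamma>: "\<gamma> \<in> hom C (src C g) D" and d: "d \<in> hom C D E"
  shows "left_split_commute C f (d \<cdot> \<alpha>) r g (d \<cdot> \<gamma>) s"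
proof -
  obtain p q where pb: "is_pullback C f g p q"
    using ex_pullback[OF pointD(1)[OF f] pointD(1)[OF g]] by blast
  obtain \<phi> where \<phi>: "\<phi> \<in> hom C (src C p) D" "\<phi> \<cdot> e1 C p q f s = \<alpha>" "\<phi> \<cdot> e2 C p q g r = \<gamma>"
    using comm left_split_commute_iff[OF f g pb \<alpha> \<gamma>] by blast
  have "(d \<cdot> \<phi>) \<cdot> e1 C p q f s = d \<cdot> \<alpha>" "(d \<cdot> \<phi>) \<cdot> e2 C p q g r = d \<cdot> \<gamma>"
    using cmp_assoc[OF e1_props(1)[OF f g pb] \<phi>(1) d] cmp_assoc[OF e2_props(1)[OF f g pb] \<phi>(1) d] \<phi>
    by simp_all
  then show ?thesis
    using left_split_commute_iff[OF f g pb cmp_in_hom[OF \<alpha> d] cmp_in_hom[OF \<gamma> d]]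
      cmp_in_hom[OF \<phi>(1) d] by blast
qed

text \<open>The induced morphism \<open>h = a \<times>\<^sub>B b\<close> between the pullbacks satisfies \<open>h e\<^sub>1 = e\<^sub>1' a\<close> and
  \<open>h e\<^sub>2 = e\<^sub>2' b\<close>, so \<open>\<phi> h\<close> connects the composites.\<close>

lemma left_split_commute_precompose:
  assumes comm: "left_split_commute C f' \<alpha>' (a \<cdot> r) g' \<gamma>' (b \<cdot> s)"
    and f': "f' \<in> hom C A' B" and g': "g' \<in> hom C E' B"
    and \<alpha>': "\<alpha>' \<in> hom C A' D" and \<gamma>': "\<gamma>' \<in> hom C E' D"
    and f: "is_point C B (f' \<cdot> a, r)" and g: "is_point C B (g' \<cdot> b, s)"
    and a: "a \<in> hom C A A'" and b: "b \<in> hom C E E'"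
  shows "left_split_commute C (f' \<cdot> a) (\<alpha>' \<cdot> a) r (g' \<cdot> b) (\<gamma>' \<cdot> b) s"
proof -
  let ?f = "f' \<cdot> a" and ?g = "g' \<cdot> b"
  have src: "src C ?f = A" "src C ?g = E" "src C f' = A'" "src C g' = E'"
    using hom_src cmp_in_hom f' g' a b by blast+
  note fh = pointD[OF f, unfolded src] and gh = pointD[OF g, unfolded src]
  have f'p: "is_point C B (f', a \<cdot> r)" and g'p: "is_point C B (g', b \<cdot> s)"
    using f' g' cmp_in_hom[OF fh(2) a] cmp_in_hom[OF gh(2) b] src
      cmp_assoc[OF fh(2) a f'] cmp_assoc[OF gh(2) b g'] fh(3) gh(3) by (auto simp: is_point_def)
  obtain p q where pb: "is_pullback C ?f ?g p q" using ex_pullback[OF fh(1) gh(1)] by blast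
  obtain p' q' where pb': "is_pullback C f' g' p' q'" using ex_pullback[OF f' g'] by blast
  note pq = pullbackD[OF pb fh(1), unfolded src] and pq' = pullbackD[OF pb' f', unfolded src]
  note i1 = e1_props[OF f g pb, unfolded src] and i2 = e2_props[OF f g pb, unfolded src]
  note j1 = e1_props[OF f'p g'p pb', unfolded src] and j2 = e2_props[OF f'p g'p pb', unfolded src]
  obtain \<phi> where \<phi>: "\<phi> \<in> hom C (src C p') D" "\<phi> \<cdot> e1 C p' q' f' (b \<cdot> s) = \<alpha>'"
    "\<phi> \<cdot> e2 C p' q' g' (a \<cdot> r) = \<gamma>'"
    using comm left_split_commute_iff[OF f'p g'p pb', unfolded src, OF \<alpha>' \<gamma>'] by blast
  have "f' \<cdot> (a \<cdot> p) = g' \<cdot> (b \<cdot> q)"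
    using pq(4) cmp_assoc[OF pq(2) a f'] cmp_assoc[OF pq(3) b g'] by simp
  then obtain h where h: "h \<in> hom C (src C p) (src C p')" "p' \<cdot> h = a \<cdot> p" "q' \<cdot> h = b \<cdot> q"
    using pullback_ex[OF pb' f' g' cmp_in_hom[OF pq(2) a] cmp_in_hom[OF pq(3) b]] by blast
  have carry: "h \<cdot> w = w'"
    if w: "w \<in> hom C Q (src C p)" and w': "w' \<in> hom C Q (src C p')"
      and "p' \<cdot> w' = a \<cdot> (p \<cdot> w)" "q' \<cdot> w' = b \<cdot> (q \<cdot> w)" for w w' Q
    using pullback_eqI[OF pb' cmp_in_hom[OF w h(1)] w'] that(3,4)
      cmp_reassoc[OF h(2) w h(1) pq'(2)] cmp_reassoc[OF h(3) w h(1) pq'(3)]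
      cmp_assoc[OF w pq(2) a] cmp_assoc[OF w pq(3) b] by simp
  have "h \<cdot> e1 C p q ?f s = e1 C p' q' f' (b \<cdot> s) \<cdot> a"
    using carry[OF i1(1) cmp_in_hom[OF a j1(1)]]
      cmp_reassoc[OF j1(2) a j1(1) pq'(2)] cmp_reassoc[OF j1(3) a j1(1) pq'(3)] i1(2,3)
      cmp_ide_left[OF a] cmp_ide_right[OF a] cmp_assoc[OF a f' cmp_in_hom[OF gh(2) b]]
      cmp_assoc[OF fh(1) gh(2) b] by simp
  then have 1: "(\<phi> \<cdot> h) \<cdot> e1 C p q ?f s = \<alpha>' \<cdot> a"
    using cmp_assoc[OF i1(1) h(1) \<phi>(1)] cmp_reassoc[OF \<phi>(2) a j1(1) \<phi>(1)] by simp
  have "h \<cdot> e2 C p q ?g r = e2 C p' q' g' (a \<cdot> r) \<cdot> b"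
    using carry[OF i2(1) cmp_in_hom[OF b j2(1)]]
      cmp_reassoc[OF j2(2) b j2(1) pq'(2)] cmp_reassoc[OF j2(3) b j2(1) pq'(3)] i2(2,3)
      cmp_ide_left[OF b] cmp_ide_right[OF b] cmp_assoc[OF b g' cmp_in_hom[OF fh(2) a]]
      cmp_assoc[OF gh(1) fh(2) a] by simp
  then have 2: "(\<phi> \<cdot> h) \<cdot> e2 C p q ?g r = \<gamma>' \<cdot> b"
    using cmp_assoc[OF i2(1) h(1) \<phi>(1)] cmp_reassoc[OF \<phi>(3) b j2(1) \<phi>(1)] by simp
  show ?thesis
    using left_split_commute_iff[OF f g pb, unfolded src, OF cmp_in_hom[OF a \<alpha>'] cmp_in_hom[OF b \<gamma>']]
      1 2 cmp_in_hom[OF h(1) \<phi>(1)] by blast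
qed

end


section \<open>Regular epimorphisms and descent of Huq-commutativity\<close>

lemma (in category) regular_epi_cancel:
  assumes "regular_epi C e" and e: "e \<in> hom C A B" and x: "x \<in> hom C B D" and y: "y \<in> hom C B D"
    and eq: "x \<cdot> e = y \<cdot> e"
  shows "x = y"
proof -
  obtain u v where coeq: "is_coequalizer C u v e" using assms(1) unfolding regular_epi_def by blast
  have tgt: "tgt C u = A" "tgt C e = B" using coeq e by (auto simp: is_coequalizer_def hom_def)
  have u: "u \<in> hom C (src C u) A" and v: "v \<in> hom C (src C u) A" and uv: "e \<cdot> u = e \<cdot> v"
    using coeq tgt by (auto simp: is_coequalizer_def hom_def)
  have "(x \<cdot> e) \<cdot> u = (x \<cdot> e) \<cdot> v" using cmp_assoc[OF u e x] cmp_assoc[OF v e x] uv by simp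
  then have "\<exists>!h. h \<in> hom C B D \<and> h \<cdot> e = x \<cdot> e"
    using coeq cmp_in_hom[OF e x] unfolding is_coequalizer_def tgt by blast
  then show ?thesis using x y eq by metis
qed

locale pointed_regular_weakly_maltsev_category = category C for C :: "('o, 'm) cat" (structure) +
  assumes is_pointed: "pointed C" and is_regular: "regular C" and is_weakly_maltsev: "weakly_maltsev C"

sublocale pointed_regular_weakly_maltsev_category \<subseteq> pointed_pullback_category
proof
  show "\<exists>Z. zero_object C Z" using is_pointed by (simp add: pointed_def)
  fix f A B g D assume "f \<in> hom C A B" "g \<in> hom C D B"
  then show "\<exists>p q. is_pullback C f g p q"
    using finitely_complete_pullback is_regular unfolding regular_def by metis
qed

context pointed_regular_weakly_maltsev_category
begin

text \<open>The stability axiom speaks of whole factorisations. Applied to the factorisation of \<open>e\<close> as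
  \<open>e\<close> followed by an identity, whose pullback along \<open>h\<close> is again an identity, it gives stability of
  regular epimorphisms alone.\<close>

lemma regular_epi_pullback:
  assumes epi: "regular_epi C e" and e: "e \<in> hom C A B" and h: "h \<in> hom C D B"
    and pb: "is_pullback C e h k e'"
  shows "regular_epi C e'"
proof -
  have obs: "B \<in> ob C" "D \<in> ob C" using hom_ob h by blast+
  note idB = ide_in_hom[OF obs(1)] and idD = ide_in_hom[OF obs(2)]
  have id_left: "ide C B \<cdot> u = u" if "u \<in> hom C Q B" for u Q using cmp_ide_left[OF that] .
  have "is_mono C (ide C B)"
    unfolding is_mono_def hom_src[OF idB] using homD[OF idB] id_left by auto
  then have fact: "regular_factorisation C e e (ide C B)"
    unfolding regular_factorisation_def
    using epi id_left[OF e] hom_tgt[OF e] hom_src[OF idB] by simp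
  have pb_id: "is_pullback C (ide C B) h h (ide C D)"
  proof (rule pullbackI[OF idB h h idD])
    show "ide C B \<cdot> h = h \<cdot> ide C D" using id_left[OF h] cmp_ide_right[OF h] by simp
  next
    fix Q u v assume "u \<in> hom C Q B" "v \<in> hom C Q D" "ide C B \<cdot> u = h \<cdot> v"
    then show "\<exists>w\<in>hom C Q D. h \<cdot> w = u \<and> ide C D \<cdot> w = v"
      using id_left cmp_ide_left by auto
  next
    fix Q w w' assume "w \<in> hom C Q D" "w' \<in> hom C Q D" "ide C D \<cdot> w = ide C D \<cdot> w'"
    then show "w = w'" using cmp_ide_left by simp
  qed
  have stable: "\<forall>f e m g m' h e' k. regular_factorisation C f e m \<and> is_pullback C m g h m' \<and>
      is_pullback C e h k e' \<longrightarrow> regular_factorisation C (m' \<cdot> e') e' m'"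
    using is_regular unfolding regular_def by blast
  have "regular_factorisation C (ide C D \<cdot> e') e' (ide C D)" using stable fact pb_id pb by blast
  then show ?thesis unfolding regular_factorisation_def by blast
qed

lemma pullback_injections_jointly_epic:
  assumes f: "is_point C B (f, r)" and g: "is_point C B (g, s)" and pb: "is_pullback C f g p q"
  shows "jointly_epic C (e1 C p q f s) (e2 C p q g r)"
  using is_weakly_maltsev pointD[OF f] pointD[OF g] pb unfolding weakly_maltsev_def by blast

lemma pullback_injections_cancel:
  assumes f: "is_point C B (f, r)" and g: "is_point C B (g, s)" and pb: "is_pullback C f g p q"
    and u: "u \<in> hom C (src C p) D" and v: "v \<in> hom C (src C p) D"
    and "u \<cdot> e1 C p q f s = v \<cdot> e1 C p q f s" "u \<cdot> e2 C p q g r = v \<cdot> e2 C p q g r"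
  shows "u = v"
proof -
  have "\<forall>Q. \<forall>u\<in>hom C (src C p) Q. \<forall>v\<in>hom C (src C p) Q.
      u \<cdot> e1 C p q f s = v \<cdot> e1 C p q f s \<and> u \<cdot> e2 C p q g r = v \<cdot> e2 C p q g r \<longrightarrow> u = v"
    using pullback_injections_jointly_epic[OF f g pb]
    unfolding jointly_epic_def hom_tgt[OF e1_props(1)[OF f g pb]] by (elim conjE)
  from this[THEN spec[of _ D], THEN bspec, OF u, THEN bspec, OF v] show ?thesis using assms(6,7) by simp
qed

text \<open>A product is a pullback over the zero object, whose section is zero; the weak Mal'tsev
  condition therefore covers its injections.\<close>

lemma product_injections_cancel:
  assumes prod: "is_product C A B p q" and A: "A \<in> ob C" and B: "B \<in> ob C"
    and u: "u \<in> hom C (src C p) D" and v: "v \<in> hom C (src C p) D"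
    and 1: "u \<cdot> pair C p q (ide C A) (\<zero> A B) = v \<cdot> pair C p q (ide C A) (\<zero> A B)"
    and 2: "u \<cdot> pair C p q (\<zero> B A) (ide C B) = v \<cdot> pair C p q (\<zero> B A) (ide C B)"
  shows "u = v"
proof -
  obtain Z where Z: "zero_object C Z" using ex_zero_object by blast
  obtain f g where f: "f \<in> hom C A Z" and g: "g \<in> hom C B Z" using to_zero_ex[OF Z] A B by blast
  obtain r s where r: "r \<in> hom C Z A" and s: "s \<in> hom C Z B" using from_zero_ex[OF Z] A B by blast
  have "ide C Z \<in> hom C Z Z" using ide_in_hom Z by (simp add: zero_object_def)
  then have "f \<cdot> r = ide C Z" "g \<cdot> s = ide C Z"
    using to_zero_eq[OF Z] cmp_in_hom[OF r f] cmp_in_hom[OF s g] by blast+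
  then have pts: "is_point C Z (f, r)" "is_point C Z (g, s)"
    using f g r s by (auto simp: is_point_def hom_def)
  have "e1 C p q f s = pair C p q (ide C A) (\<zero> A B)" "e2 C p q g r = pair C p q (\<zero> B A) (ide C B)"
    unfolding e1_def e2_def hom_src[OF f] hom_src[OF g]
    using zero_mor_eqI[OF Z f s] zero_mor_eqI[OF Z g r] by simp_all
  with pullback_injections_cancel[OF pts _ u v] product_iff_pullback_over_zero[OF Z f g] prod 1 2
  show ?thesis by simp
qed

text \<open>The morphism \<open>e \<times> B\<close> is the pullback of \<open>e\<close> along the projection \<open>A' \<times> B \<rightarrow> A'\<close>.\<close>

lemma regular_epi_times_object:
  assumes epi: "regular_epi C e" and e: "e \<in> hom C A A'"
    and prod: "is_product C A B p q" and prod': "is_product C A' B p' q'"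
  shows "regular_epi C (pair C p' q' (e \<cdot> p) q)"
proof -
  note pq = productD[OF prod] and pq' = productD[OF prod']
  note E = product_pair[OF prod' cmp_in_hom[OF pq(1) e] pq(2)]
  have "is_pullback C e p' p (pair C p' q' (e \<cdot> p) q)"
  proof (rule pullbackI[OF e pq'(1) pq(1) E(1)])
    show "e \<cdot> p = p' \<cdot> pair C p' q' (e \<cdot> p) q" using E(2) by simp
  next
    fix Q u v assume u: "u \<in> hom C Q A" and v: "v \<in> hom C Q (src C p')" and eq: "e \<cdot> u = p' \<cdot> v"
    note q'v = cmp_in_hom[OF v pq'(2)]
    note h = product_pair[OF prod u q'v] and h' = product_pair[OF prod' cmp_in_hom[OF u e] q'v]
    have "pair C p' q' (e \<cdot> p) q \<cdot> pair C p q u (q' \<cdot> v) = v"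
      using map_pair_left[OF prod prod' e u q'v] product_eqI[OF prod' h'(1) v] h'(2,3) eq by simp
    then show "\<exists>h\<in>hom C Q (src C p). p \<cdot> h = u \<and> pair C p' q' (e \<cdot> p) q \<cdot> h = v" using h by blast
  next
    fix Q h h' assume h: "h \<in> hom C Q (src C p)" "h' \<in> hom C Q (src C p)" "p \<cdot> h = p \<cdot> h'"
      and eq: "pair C p' q' (e \<cdot> p) q \<cdot> h = pair C p' q' (e \<cdot> p) q \<cdot> h'"
    have "q \<cdot> h = q \<cdot> h'"
      using cmp_reassoc[OF E(3) h(1) E(1) pq'(2)] cmp_reassoc[OF E(3) h(2) E(1) pq'(2)] eq by simp
    then show "h = h'" using product_eqI[OF prod h] by blast
  qed
  from regular_epi_pullback[OF epi e pq'(1) this] show ?thesis .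
qed

text \<open>A connecting morphism \<open>\<phi> : A \<times> B \<rightarrow> D\<close> for \<open>\<iota> e\<close> and \<open>\<gamma>\<close> has to be factored through the regular
  epimorphism \<open>e \<times> B\<close>. The kernel pair of \<open>e \<times> B\<close> is \<open>K \<times> B\<close>, where \<open>K\<close> is that of \<open>e\<close>. By the weak
  Mal'tsev condition \<open>\<phi>\<close> coequalizes its two projections as soon as it does so on the injections of
  \<open>K\<close> and of \<open>B\<close>: on \<open>K\<close> because \<open>\<phi>\<close> restricts to \<open>\<iota> e\<close> on \<open>A\<close>, on \<open>B\<close> because both projections
  restrict to the injection of \<open>B\<close>.\<close>

lemma huq_commute_descends:
  assumes huq: "huq_commute C (\<iota> \<cdot> e) \<gamma>" and epi: "regular_epi C e"
    and e: "e \<in> hom C A A'" and \<iota>: "\<iota> \<in> hom C A' D" and \<gamma>: "\<gamma> \<in> hom C B D"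
  shows "huq_commute C \<iota> \<gamma>"
proof -
  have obs: "A \<in> ob C" "A' \<in> ob C" "B \<in> ob C" using hom_ob e \<gamma> by blast+
  obtain p q where prod: "is_product C A B p q" using ex_product obs by blast
  obtain p' q' where prod': "is_product C A' B p' q'" using ex_product obs by blast
  note pq = productD[OF prod] and pq' = productD[OF prod']
  define E where "E = pair C p' q' (e \<cdot> p) q"
  note E = product_pair[OF prod' cmp_in_hom[OF pq(1) e] pq(2), folded E_def]
  obtain \<phi> where \<phi>: "\<phi> \<in> hom C (src C p) D"
    and \<phi>1: "\<phi> \<cdot> pair C p q (ide C A) (\<zero> A B) = \<iota> \<cdot> e"
    and \<phi>2: "\<phi> \<cdot> pair C p q (\<zero> B A) (ide C B) = \<gamma>"
    using huq huq_commute_iff[OF cmp_in_hom[OF e \<iota>] \<gamma> prod] by blast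
  have inj: "ide C X \<in> hom C X X" "\<zero> X B \<in> hom C X B" "\<zero> B X \<in> hom C B X" "ide C B \<in> hom C B B"
    if "X \<in> ob C" for X using ide_in_hom zero_in_hom that obs by blast+
  note inj_A = product_pair(1)[OF prod inj(1,2)[OF obs(1)]] product_pair(1)[OF prod inj(3,4)[OF obs(1)]]
  have inj_left: "pair C p1 q1 (ide C Y) (\<zero> Y B) \<cdot> a = pair C p1 q1 a (\<zero> X B)"
    if "is_product C Y B p1 q1" "a \<in> hom C X Y" for p1 q1 a X Y
    using cmp_pair[OF that(1) inj(1,2) that(2)] hom_ob[OF that(2)] cmp_ide_left[OF that(2)]
      zero_left[OF obs(3) that(2)] by simp
  have map_inj: "pair C p1 q1 (a \<cdot> p2) q2 \<cdot> pair C p2 q2 (ide C X) (\<zero> X B)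
        = pair C p1 q1 (ide C Y) (\<zero> Y B) \<cdot> a"
      "pair C p1 q1 (a \<cdot> p2) q2 \<cdot> pair C p2 q2 (\<zero> B X) (ide C B) = pair C p1 q1 (\<zero> B Y) (ide C B)"
    if "is_product C X B p2 q2" "is_product C Y B p1 q1" "a \<in> hom C X Y" for p1 q1 p2 q2 a X Y
    using map_pair_left[OF that inj(1,2)] hom_ob[OF that(3)]
      map_pair_left[OF that inj(3,4)[OF conjunct1[OF hom_ob[OF that(3)]]]]
      inj_left[OF that(2,3)] cmp_ide_right[OF that(3)] zero_right[OF obs(3) that(3)] by simp_all
  \<comment> \<open>\<open>\<phi>\<close> identifies the two projections \<open>U, V : K \<times> B \<rightarrow> A \<times> B\<close> of the kernel pair of \<open>e \<times> B\<close>.\<close>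
  obtain u v where ker_pair: "is_pullback C e e u v" using ex_pullback[OF e e] by blast
  define K where "K = src C u"
  have u: "u \<in> hom C K A" and v: "v \<in> hom C K A" and uv: "e \<cdot> u = e \<cdot> v"
    using pullbackD(2,3,4)[OF ker_pair e] hom_src[OF e] by (auto simp: K_def)
  have K: "K \<in> ob C" using hom_ob u by blast
  obtain pk qk where prodK: "is_product C K B pk qk" using ex_product K obs by blast
  note pqk = productD[OF prodK]
  define U where "U = pair C p q (u \<cdot> pk) qk"
  define V where "V = pair C p q (v \<cdot> pk) qk"
  note U = product_pair[OF prod cmp_in_hom[OF pqk(1) u] pqk(2), folded U_def]
  note V = product_pair[OF prod cmp_in_hom[OF pqk(1) v] pqk(2), folded V_def]
  note inj_K = product_pair(1)[OF prodK inj(1,2)[OF K]] product_pair(1)[OF prodK inj(3,4)[OF K]]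
  have \<phi>UV: "\<phi> \<cdot> U = \<phi> \<cdot> V"
  proof (rule product_injections_cancel[OF prodK K obs(3) cmp_in_hom[OF U(1) \<phi>] cmp_in_hom[OF V(1) \<phi>]])
    have "(\<phi> \<cdot> pair C p q (ide C A) (\<zero> A B)) \<cdot> u = (\<phi> \<cdot> pair C p q (ide C A) (\<zero> A B)) \<cdot> v"
      using \<phi>1 cmp_assoc[OF u e \<iota>] cmp_assoc[OF v e \<iota>] uv by simp
    then show "(\<phi> \<cdot> U) \<cdot> pair C pk qk (ide C K) (\<zero> K B) = (\<phi> \<cdot> V) \<cdot> pair C pk qk (ide C K) (\<zero> K B)"
      using cmp_assoc[OF inj_K(1) U(1) \<phi>] cmp_assoc[OF inj_K(1) V(1) \<phi>]
        map_inj(1)[OF prodK prod u] map_inj(1)[OF prodK prod v]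
        cmp_assoc[OF u inj_A(1) \<phi>] cmp_assoc[OF v inj_A(1) \<phi>] by (simp add: U_def V_def)
    show "(\<phi> \<cdot> U) \<cdot> pair C pk qk (\<zero> B K) (ide C B) = (\<phi> \<cdot> V) \<cdot> pair C pk qk (\<zero> B K) (ide C B)"
      using cmp_assoc[OF inj_K(2) U(1) \<phi>] cmp_assoc[OF inj_K(2) V(1) \<phi>]
        map_inj(2)[OF prodK prod u] map_inj(2)[OF prodK prod v] by (simp add: U_def V_def)
  qed
  \<comment> \<open>\<open>E\<close> is a coequalizer of some \<open>a, b\<close>; these factor through the kernel pair as \<open>U t\<close>, \<open>V t\<close>.\<close>
  have "regular_epi C E" unfolding E_def by (rule regular_epi_times_object[OF epi e prod prod'])
  then obtain a b where coeq: "is_coequalizer C a b E" unfolding regular_epi_def by blast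
  define W where "W = src C a"
  have a: "a \<in> hom C W (src C p)" and b: "b \<in> hom C W (src C p)" and ab: "E \<cdot> a = E \<cdot> b"
    using coeq homD[OF E(1)] unfolding is_coequalizer_def W_def by (auto simp: hom_def)
  have "(e \<cdot> p) \<cdot> a = (e \<cdot> p) \<cdot> b" and qab: "q \<cdot> a = q \<cdot> b"
    using cmp_reassoc[OF E(2) a E(1) pq'(1)] cmp_reassoc[OF E(2) b E(1) pq'(1)]
      cmp_reassoc[OF E(3) a E(1) pq'(2)] cmp_reassoc[OF E(3) b E(1) pq'(2)] ab by simp_all
  then have "e \<cdot> (p \<cdot> a) = e \<cdot> (p \<cdot> b)" using cmp_assoc[OF a pq(1) e] cmp_assoc[OF b pq(1) e] by simp
  then obtain w where w: "w \<in> hom C W K" "u \<cdot> w = p \<cdot> a" "v \<cdot> w = p \<cdot> b"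
    using pullback_ex[OF ker_pair e e cmp_in_hom[OF a pq(1)] cmp_in_hom[OF b pq(1)]] K_def by blast
  note qa = cmp_in_hom[OF a pq(2)]
  define t where "t = pair C pk qk w (q \<cdot> a)"
  note t = product_pair(1)[OF prodK w(1) qa, folded t_def]
  have "U \<cdot> t = pair C p q (p \<cdot> a) (q \<cdot> a)" "V \<cdot> t = pair C p q (p \<cdot> b) (q \<cdot> b)"
    using map_pair_left[OF prodK prod u w(1) qa] map_pair_left[OF prodK prod v w(1) qa] w qab
    by (simp_all add: U_def V_def t_def)
  moreover have "pair C p q (p \<cdot> x) (q \<cdot> x) = x" if x: "x \<in> hom C W (src C p)" for x
    using product_pair[OF prod cmp_in_hom[OF x pq(1)] cmp_in_hom[OF x pq(2)]]
      product_eqI[OF prod _ x] by blast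
  ultimately have "a = U \<cdot> t" "b = V \<cdot> t" using a b by simp_all
  then have "\<phi> \<cdot> a = \<phi> \<cdot> b" using cmp_assoc[OF t U(1) \<phi>] cmp_assoc[OF t V(1) \<phi>] \<phi>UV by simp
  then obtain \<psi> where \<psi>: "\<psi> \<in> hom C (src C p') D" "\<psi> \<cdot> E = \<phi>"
    using coeq homD[OF E(1)] homD[OF a] \<phi> unfolding is_coequalizer_def by metis
  note inj_A' = product_pair(1)[OF prod' inj(1,2)[OF obs(2)]] product_pair(1)[OF prod' inj(3,4)[OF obs(2)]]
  have "\<psi> \<cdot> pair C p' q' (ide C A') (\<zero> A' B) = \<iota>"
  proof (rule regular_epi_cancel[OF epi e cmp_in_hom[OF inj_A'(1) \<psi>(1)] \<iota>])
    show "(\<psi> \<cdot> pair C p' q' (ide C A') (\<zero> A' B)) \<cdot> e = \<iota> \<cdot> e"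
      using cmp_assoc[OF e inj_A'(1) \<psi>(1)] map_inj(1)[OF prod prod' e]
        cmp_reassoc[OF \<psi>(2) inj_A(1) E(1) \<psi>(1)] \<phi>1 by (simp add: E_def)
  qed
  moreover have "\<psi> \<cdot> pair C p' q' (\<zero> B A') (ide C B) = \<gamma>"
    using map_inj(2)[OF prod prod' e] cmp_reassoc[OF \<psi>(2) inj_A(2) E(1) \<psi>(1)] \<phi>2 by (simp add: E_def)
  ultimately show ?thesis using huq_commute_iff[OF \<iota> \<gamma> prod'] \<psi>(1) by blast
qed

text \<open>Factor \<open>\<langle>f, \<alpha>\<rangle>\<close> as a monomorphism \<open>m\<close> after \<open>e\<close>. The components of a monomorphism into a product
  are jointly monomorphic.\<close>

lemma regular_image_of_pair:
  assumes f: "f \<in> hom C A B" and \<alpha>: "\<alpha> \<in> hom C A D"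
  obtains A' e f' \<alpha>' where "e \<in> hom C A A'" "regular_epi C e" "f' \<in> hom C A' B" "\<alpha>' \<in> hom C A' D"
    "f' \<cdot> e = f" "\<alpha>' \<cdot> e = \<alpha>" "jointly_monic C f' \<alpha>'"
proof -
  have obs: "B \<in> ob C" "D \<in> ob C" using hom_ob f \<alpha> by blast+
  obtain p q where prod: "is_product C B D p q" using ex_product obs by blast
  note pq = productD[OF prod] and x = product_pair[OF prod f \<alpha>]
  obtain e m where fact: "regular_factorisation C (pair C p q f \<alpha>) e m"
    using is_regular homD[OF x(1)] unfolding regular_def by blast
  have epi: "regular_epi C e" and mono: "is_mono C m" and em: "tgt C e = src C m"
    and eq: "m \<cdot> e = pair C p q f \<alpha>" using fact unfolding regular_factorisation_def by auto
  have e0: "e \<in> hom C (src C e) (src C m)"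
    using epi em unfolding regular_epi_def is_coequalizer_def by (auto simp: hom_def)
  have m0: "m \<in> hom C (src C m) (tgt C m)" using mono by (simp add: is_mono_def hom_def)
  have e: "e \<in> hom C A (src C m)" and m: "m \<in> hom C (src C m) (src C p)"
    using cmp_in_hom[OF e0 m0] eq x(1) e0 m0 by (auto simp: hom_def)
  note pm = cmp_in_hom[OF m pq(1)] and qm = cmp_in_hom[OF m pq(2)]
  have "jointly_monic C (p \<cdot> m) (q \<cdot> m)"
    unfolding jointly_monic_def hom_src[OF pm] hom_src[OF qm]
  proof (intro conjI allI ballI impI)
    fix Q u v assume u: "u \<in> hom C Q (src C m)" and v: "v \<in> hom C Q (src C m)"
      and "(p \<cdot> m) \<cdot> u = (p \<cdot> m) \<cdot> v \<and> (q \<cdot> m) \<cdot> u = (q \<cdot> m) \<cdot> v"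
    then have "p \<cdot> (m \<cdot> u) = p \<cdot> (m \<cdot> v)" "q \<cdot> (m \<cdot> u) = q \<cdot> (m \<cdot> v)"
      using cmp_assoc[OF u m pq(1)] cmp_assoc[OF v m pq(1)] cmp_assoc[OF u m pq(2)]
        cmp_assoc[OF v m pq(2)] by simp_all
    then have "m \<cdot> u = m \<cdot> v" using product_eqI[OF prod cmp_in_hom[OF u m] cmp_in_hom[OF v m]] by blast
    then show "u = v" using mono u v unfolding is_mono_def by blast
  qed (use homD[OF pm] homD[OF qm] in auto)
  moreover have "(p \<cdot> m) \<cdot> e = f" "(q \<cdot> m) \<cdot> e = \<alpha>"
    using cmp_assoc[OF e m pq(1)] cmp_assoc[OF e m pq(2)] eq x(2,3) by simp_all
  ultimately show ?thesis using that[OF e epi pm qm] by blast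
qed

text \<open>The kernel of \<open>f' e\<close> is the pullback along \<open>e\<close> of the kernel of \<open>f'\<close>, so the comparison of kernels
  is a pullback of \<open>e\<close>.\<close>

lemma kernel_comparison_regular_epi:
  assumes e: "e \<in> hom C A A'" and epi: "regular_epi C e" and f': "f' \<in> hom C A' B"
    and k: "is_kernel C (f' \<cdot> e) k" and k': "is_kernel C f' k'"
  obtains e' where "e' \<in> hom C (src C k) (src C k')" "k' \<cdot> e' = e \<cdot> k" "regular_epi C e'"
proof -
  note fe = cmp_in_hom[OF e f']
  note kh = kernelD[OF k fe] and kh' = kernelD[OF k' f']
  have B: "B \<in> ob C" using hom_ob f' by blast
  have "f' \<cdot> (e \<cdot> k) = \<zero> (src C k) B" using kh(2) cmp_assoc[OF kh(1) e f'] by simp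
  then obtain e' where e': "e' \<in> hom C (src C k) (src C k')" "k' \<cdot> e' = e \<cdot> k"
    using kernel_ex[OF k' f' cmp_in_hom[OF kh(1) e]] by blast
  have "is_pullback C e k' k e'"
  proof (rule pullbackI[OF e kh'(1) kh(1) e'(1)])
    show "e \<cdot> k = k' \<cdot> e'" using e' by simp
  next
    fix Q u v assume u: "u \<in> hom C Q A" and v: "v \<in> hom C Q (src C k')" and eq: "e \<cdot> u = k' \<cdot> v"
    have "(f' \<cdot> e) \<cdot> u = \<zero> Q B"
      using cmp_assoc[OF u e f'] eq cmp_reassoc[OF kh'(2) v kh'(1) f'] zero_left[OF B v] by simp
    then obtain h where h: "h \<in> hom C Q (src C k)" "k \<cdot> h = u" using kernel_ex[OF k fe u] by blast
    have "k' \<cdot> (e' \<cdot> h) = k' \<cdot> v"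
      using cmp_reassoc[OF e'(2) h(1) e'(1) kh'(1)] cmp_assoc[OF h(1) kh(1) e] h(2) eq by simp
    then have "e' \<cdot> h = v" using kernel_eqI[OF k' cmp_in_hom[OF h(1) e'(1)] v] by blast
    then show "\<exists>h\<in>hom C Q (src C k). k \<cdot> h = u \<and> e' \<cdot> h = v" using h by blast
  next
    fix Q h h' assume "h \<in> hom C Q (src C k)" "h' \<in> hom C Q (src C k)" "k \<cdot> h = k \<cdot> h'"
    then show "h = h'" using kernel_eqI[OF k] by blast
  qed
  from that[OF e' regular_epi_pullback[OF epi e kh'(1) this]] show ?thesis .
qed

end


section \<open>The category of points\<close>

lemma Pt_simps [simp]:
  "ob (Pt C B) = {P. is_point C B P}"
  "src (Pt C B) (P, f, P') = P" "tgt (Pt C B) (P, f, P') = P'"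
  "ide (Pt C B) P = (P, ide C (src C (fst P)), P)"
  "(P1, g, P') \<cdot>\<^bsub>Pt C B\<^esub> (P, f, P2) = (P, g \<cdot>\<^bsub>C\<^esub> f, P')"
  by (simp_all add: Pt_def)

lemma mor_Pt_iff:
  "(P, f, P') \<in> mor (Pt C B) \<longleftrightarrow> is_point C B P \<and> is_point C B P' \<and> is_point_mor C P f P'"
  by (simp add: Pt_def)

lemma hom_Pt_iff:
  "x \<in> hom (Pt C B) P P' \<longleftrightarrow>
    is_point C B P \<and> is_point C B P' \<and> (\<exists>f. x = (P, f, P') \<and> is_point_mor C P f P')"
  by (cases x) (auto simp: hom_def mor_Pt_iff)

context pointed_pullback_category
begin

lemma point_morD:
  assumes "is_point_mor C (f, r) x (g, s)"
  shows "x \<in> hom C (src C f) (src C g)" "g \<cdot> x = f" "x \<cdot> r = s"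
  using assms by (auto simp: is_point_mor_def)

lemma point_mor_cmp:
  assumes "is_point C B (f, r)" "is_point C B (g, s)" "is_point C B (t, \<sigma>)"
    and x: "is_point_mor C (f, r) x (g, s)" and y: "is_point_mor C (g, s) y (t, \<sigma>)"
  shows "is_point_mor C (f, r) (y \<cdot> x) (t, \<sigma>)"
proof -
  note xh = point_morD[OF x] and yh = point_morD[OF y]
  note f = pointD[OF assms(1)] and t = pointD[OF assms(3)]
  show ?thesis unfolding is_point_mor_def
    using cmp_in_hom[OF xh(1) yh(1)] cmp_reassoc[OF yh(2) xh(1) yh(1) t(1)]
      cmp_assoc[OF f(2) xh(1) yh(1)] xh yh by simp
qed

lemma point_mor_ide: "is_point C B (f, r) \<Longrightarrow> is_point_mor C (f, r) (ide C (src C f)) (f, r)"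
  using cmp_ide_left cmp_ide_right ide_in_hom hom_ob pointD[of B f r]
  unfolding is_point_mor_def by auto

lemma category_Pt: "category (Pt C B)"
proof
  fix x assume "x \<in> mor (Pt C B)"
  then show "src (Pt C B) x \<in> ob (Pt C B)" "tgt (Pt C B) x \<in> ob (Pt C B)"
    by (cases x; auto simp: mor_Pt_iff)+
next
  fix P assume "P \<in> ob (Pt C B)"
  then show "ide (Pt C B) P \<in> hom (Pt C B) P P"
    using point_mor_ide by (cases P) (auto simp: hom_Pt_iff)
next
  fix P Q R x y assume "x \<in> hom (Pt C B) P Q" "y \<in> hom (Pt C B) Q R"
  then show "y \<cdot>\<^bsub>Pt C B\<^esub> x \<in> hom (Pt C B) P R"
    by (cases P; cases Q; cases R) (auto simp: hom_Pt_iff intro: point_mor_cmp)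
next
  fix P Q x assume "x \<in> hom (Pt C B) P Q"
  then show "ide (Pt C B) Q \<cdot>\<^bsub>Pt C B\<^esub> x = x" "x \<cdot>\<^bsub>Pt C B\<^esub> ide (Pt C B) P = x"
    using cmp_ide_left cmp_ide_right
    by (cases P; cases Q; auto simp: hom_Pt_iff is_point_mor_def)+
next
  fix P Q R S x y z assume "x \<in> hom (Pt C B) P Q" "y \<in> hom (Pt C B) Q R" "z \<in> hom (Pt C B) R S"
  then show "(z \<cdot>\<^bsub>Pt C B\<^esub> y) \<cdot>\<^bsub>Pt C B\<^esub> x = z \<cdot>\<^bsub>Pt C B\<^esub> (y \<cdot>\<^bsub>Pt C B\<^esub> x)"
    using cmp_assoc
    by (cases P; cases Q; cases R; cases S) (auto simp: hom_Pt_iff is_point_mor_def)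
qed

text \<open>The only morphism from \<open>(f, r)\<close> to the identity point is \<open>f\<close>, and the only one back is \<open>r\<close>.\<close>

lemma zero_object_Pt:
  assumes B: "B \<in> ob C"
  shows "zero_object (Pt C B) (ide C B, ide C B)"
proof -
  note idB = ide_in_hom[OF B]
  have Z: "is_point C B (ide C B, ide C B)"
    using idB cmp_ide_left[OF idB] by (auto simp: is_point_def hom_def)
  have into: "x \<in> hom (Pt C B) (f, r) (ide C B, ide C B) \<longleftrightarrow> x = ((f, r), f, (ide C B, ide C B))"
    and out: "x \<in> hom (Pt C B) (ide C B, ide C B) (f, r) \<longleftrightarrow> x = ((ide C B, ide C B), r, (f, r))"
    if f: "is_point C B (f, r)" for f r x
  proof -
    note fh = pointD[OF f]
    show "x \<in> hom (Pt C B) (f, r) (ide C B, ide C B) \<longleftrightarrow> x = ((f, r), f, (ide C B, ide C B))"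
      using f Z fh cmp_ide_left hom_src[OF idB] by (auto simp: hom_Pt_iff is_point_mor_def)
    show "x \<in> hom (Pt C B) (ide C B, ide C B) (f, r) \<longleftrightarrow> x = ((ide C B, ide C B), r, (f, r))"
      using f Z fh cmp_ide_right hom_src[OF idB] by (auto simp: hom_Pt_iff is_point_mor_def)
  qed
  show ?thesis unfolding zero_object_def using Z into out by auto
qed

lemma pointed_Pt: "B \<in> ob C \<Longrightarrow> pointed_category (Pt C B)"
  using category_Pt zero_object_Pt by (auto simp: pointed_category_def pointed_category_axioms_def)

lemma zero_mor_Pt:
  assumes B: "B \<in> ob C" and f: "is_point C B (f, r)" and g: "is_point C B (g, s)"
  shows "\<zero>\<^bsub>Pt C B\<^esub> (f, r) (g, s) = ((f, r), s \<cdot> f, (g, s))"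
proof -
  note idB = ide_in_hom[OF B] and fh = pointD[OF f] and gh = pointD[OF g]
  have Z: "is_point C B (ide C B, ide C B)" using zero_object_Pt[OF B] by (simp add: zero_object_def)
  have "((f, r), f, (ide C B, ide C B)) \<in> hom (Pt C B) (f, r) (ide C B, ide C B)"
    "((ide C B, ide C B), s, (g, s)) \<in> hom (Pt C B) (ide C B, ide C B) (g, s)"
    using f g Z fh gh cmp_ide_left[OF fh(1)] cmp_ide_right[OF gh(2)] hom_src[OF idB]
    by (auto simp: hom_Pt_iff is_point_mor_def)
  from pointed_category.zero_mor_eqI[OF pointed_Pt[OF B] zero_object_Pt[OF B] this] show ?thesis by simp
qed

lemma pullback_point:
  assumes f: "is_point C B (f, r)" and g: "is_point C B (g, s)" and pb: "is_pullback C f g p q"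
  shows "is_point C B (f \<cdot> p, pair C p q r s)"
    and "is_point_mor C (f \<cdot> p, pair C p q r s) p (f, r)"
    and "is_point_mor C (f \<cdot> p, pair C p q r s) q (g, s)"
    and "src C (f \<cdot> p) = src C p"
    and "e1 C p q f s \<cdot> r = pair C p q r s" and "e2 C p q g r \<cdot> s = pair C p q r s"
proof -
  note fh = pointD[OF f] and gh = pointD[OF g]
  note pq = pullbackD[OF pb fh(1)]
  have "f \<cdot> r = g \<cdot> s" using fh gh by simp
  note \<sigma> = pullback_pair[OF pb fh(1) gh(1) fh(2) gh(2) this]
  note fp = cmp_in_hom[OF pq(2) fh(1)]
  show src: "src C (f \<cdot> p) = src C p" by (rule hom_src[OF fp])
  show "is_point C B (f \<cdot> p, pair C p q r s)"
    using fp \<sigma> src cmp_assoc[OF \<sigma>(1) pq(2) fh(1)] fh(3) by (simp add: is_point_def)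
  show "is_point_mor C (f \<cdot> p, pair C p q r s) p (f, r)"
    "is_point_mor C (f \<cdot> p, pair C p q r s) q (g, s)"
    using src pq \<sigma> by (simp_all add: is_point_mor_def)
  note i1 = e1_props[OF f g pb] and i2 = e2_props[OF f g pb]
  show "e1 C p q f s \<cdot> r = pair C p q r s"
    using pullback_eqI[OF pb cmp_in_hom[OF fh(2) i1(1)] \<sigma>(1)] \<sigma>(2,3)
      cmp_reassoc[OF i1(2) fh(2) i1(1) pq(2)] cmp_reassoc[OF i1(3) fh(2) i1(1) pq(3)]
      cmp_ide_left[OF fh(2)] cmp_assoc[OF fh(2,1) gh(2)] fh(3) cmp_ide_right[OF gh(2)] by simp
  show "e2 C p q g r \<cdot> s = pair C p q r s"
    using pullback_eqI[OF pb cmp_in_hom[OF gh(2) i2(1)] \<sigma>(1)] \<sigma>(2,3)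
      cmp_reassoc[OF i2(2) gh(2) i2(1) pq(2)] cmp_reassoc[OF i2(3) gh(2) i2(1) pq(3)]
      cmp_ide_left[OF gh(2)] cmp_assoc[OF gh(2,1) fh(2)] gh(3) cmp_ide_right[OF fh(2)] by simp
qed

lemma product_Pt:
  assumes f: "is_point C B (f, r)" and g: "is_point C B (g, s)" and pb: "is_pullback C f g p q"
  defines "E \<equiv> (f \<cdot> p, pair C p q r s)"
  shows "is_product (Pt C B) (f, r) (g, s) (E, p, (f, r)) (E, q, (g, s))"
proof -
  interpret Pt: category "Pt C B" by (rule category_Pt)
  note fh = pointD[OF f] and gh = pointD[OF g]
  note pq = pullbackD[OF pb fh(1)]
  note E = pullback_point[OF f g pb, folded E_def]
  have "f \<cdot> r = g \<cdot> s" using fh gh by simp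
  note \<sigma> = pullback_pair[OF pb fh(1) gh(1) fh(2) gh(2) this]
  show ?thesis
  proof (rule Pt.productI[where P = E])
    show "(E, p, (f, r)) \<in> hom (Pt C B) E (f, r)" "(E, q, (g, s)) \<in> hom (Pt C B) E (g, s)"
      using E f g by (simp_all add: hom_Pt_iff)
  next
    fix P u v assume u: "u \<in> hom (Pt C B) P (f, r)" and v: "v \<in> hom (Pt C B) P (g, s)"
    obtain t \<tau> where P: "P = (t, \<tau>)" by (cases P)
    have tp: "is_point C B (t, \<tau>)" using u by (simp add: hom_Pt_iff P)
    obtain x where x: "u = (P, x, (f, r))" "is_point_mor C (t, \<tau>) x (f, r)"
      using u by (auto simp: hom_Pt_iff P)
    obtain y where y: "v = (P, y, (g, s))" "is_point_mor C (t, \<tau>) y (g, s)"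
      using v by (auto simp: hom_Pt_iff P)
    note xh = point_morD[OF x(2)] and yh = point_morD[OF y(2)] and th = pointD[OF tp]
    have "f \<cdot> x = g \<cdot> y" using xh yh by simp
    then obtain h where h: "h \<in> hom C (src C t) (src C p)" "p \<cdot> h = x" "q \<cdot> h = y"
      using pullback_ex[OF pb fh(1) gh(1) xh(1) yh(1)] by blast
    have "h \<cdot> \<tau> = pair C p q r s"
      using pullback_eqI[OF pb cmp_in_hom[OF th(2) h(1)] \<sigma>(1)] \<sigma>(2,3) xh yh
        cmp_reassoc[OF h(2) th(2) h(1) pq(2)] cmp_reassoc[OF h(3) th(2) h(1) pq(3)] by simp
    moreover have "(f \<cdot> p) \<cdot> h = t" using cmp_assoc[OF h(1) pq(2) fh(1)] h(2) xh by simp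
    ultimately have "is_point_mor C (t, \<tau>) h E"
      using h(1) E(4) by (simp add: is_point_mor_def E_def)
    then show "\<exists>h\<in>hom (Pt C B) P E.
        (E, p, (f, r)) \<cdot>\<^bsub>Pt C B\<^esub> h = u \<and> (E, q, (g, s)) \<cdot>\<^bsub>Pt C B\<^esub> h = v"
      using tp E(1) h x y by (intro bexI[of _ "(P, h, E)"]) (simp_all add: hom_Pt_iff P)
  next
    fix P h h' assume "h \<in> hom (Pt C B) P E" "h' \<in> hom (Pt C B) P E"
      and eq: "(E, p, (f, r)) \<cdot>\<^bsub>Pt C B\<^esub> h = (E, p, (f, r)) \<cdot>\<^bsub>Pt C B\<^esub> h'"
        "(E, q, (g, s)) \<cdot>\<^bsub>Pt C B\<^esub> h = (E, q, (g, s)) \<cdot>\<^bsub>Pt C B\<^esub> h'"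
    then obtain w w' where w: "h = (P, w, E)" "h' = (P, w', E)"
      "is_point_mor C P w E" "is_point_mor C P w' E" by (auto simp: hom_Pt_iff)
    then have "w \<in> hom C (src C (fst P)) (src C p)" "w' \<in> hom C (src C (fst P)) (src C p)"
      using E(4) by (cases P; simp add: is_point_mor_def E_def)+
    then have "w = w'" using pullback_eqI[OF pb] eq w(1,2) by simp
    then show "h = h'" using w by simp
  qed
qed

end

text \<open>Products in the category of points are pullbacks in the base, and their injections are
  \<open>e1\<close> and \<open>e2\<close>. That the connecting morphism is automatically compatible with the projections to
  \<open>B\<close> is due to the joint epimorphy of \<open>e1\<close> and \<open>e2\<close>.\<close>

lemma (in pointed_regular_weakly_maltsev_category) huq_commute_Pt_iff_left_split_commute:
  assumes B: "B \<in> ob C" and f: "is_point C B (f, r)" and g: "is_point C B (g, s)"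
    and t: "is_point C B (t, \<sigma>)"
    and x: "is_point_mor C (f, r) x (t, \<sigma>)" and y: "is_point_mor C (g, s) y (t, \<sigma>)"
  shows "huq_commute (Pt C B) ((f, r), x, (t, \<sigma>)) ((g, s), y, (t, \<sigma>)) \<longleftrightarrow>
    left_split_commute C f x r g y s"
proof -
  interpret Pt: pointed_category "Pt C B" by (rule pointed_Pt[OF B])
  note fh = pointD[OF f] and gh = pointD[OF g] and th = pointD[OF t]
  note xh = point_morD[OF x] and yh = point_morD[OF y]
  obtain p q where pb: "is_pullback C f g p q" using ex_pullback[OF fh(1) gh(1)] by blast
  note pq = pullbackD[OF pb fh(1)]
  define E where "E = (f \<cdot> p, pair C p q r s)"
  note E = pullback_point[OF f g pb, folded E_def]
  note prod = product_Pt[OF f g pb, folded E_def]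
  note i1 = e1_props[OF f g pb] and i2 = e2_props[OF f g pb]
  have fp1: "(f \<cdot> p) \<cdot> e1 C p q f s = f"
    using cmp_assoc[OF i1(1) pq(2) fh(1)] i1(2) cmp_ide_right[OF fh(1)] by simp
  have fp2: "(f \<cdot> p) \<cdot> e2 C p q g r = g"
    using cmp_assoc[OF i2(1) pq(3) gh(1)] i2(3) cmp_ide_right[OF gh(1)] pq(4) by simp
  have I1: "((f, r), e1 C p q f s, E) \<in> hom (Pt C B) (f, r) E"
    using f E i1(1) fp1 by (simp add: hom_Pt_iff is_point_mor_def E_def)
  have I2: "((g, s), e2 C p q g r, E) \<in> hom (Pt C B) (g, s) E"
    using g E i2(1) fp2 by (simp add: hom_Pt_iff is_point_mor_def E_def)
  have obs: "(f, r) \<in> ob (Pt C B)" "(g, s) \<in> ob (Pt C B)" using f g by simp_all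
  note P1 = Pt.product_pair[OF prod Pt.ide_in_hom[OF obs(1)] Pt.zero_in_hom[OF obs]]
  note P2 = Pt.product_pair[OF prod Pt.zero_in_hom[OF obs(2,1)] Pt.ide_in_hom[OF obs(2)]]
  have pair1: "pair (Pt C B) (E, p, (f, r)) (E, q, (g, s)) (ide (Pt C B) (f, r))
      (\<zero>\<^bsub>Pt C B\<^esub> (f, r) (g, s)) = ((f, r), e1 C p q f s, E)"
  proof (rule Pt.product_eqI[OF prod P1(1)])
    show "((f, r), e1 C p q f s, E) \<in> hom (Pt C B) (f, r) (src (Pt C B) (E, p, (f, r)))"
      using I1 by simp
  qed (unfold P1(2,3), unfold zero_mor_Pt[OF B f g], use i1 in simp_all)
  have pair2: "pair (Pt C B) (E, p, (f, r)) (E, q, (g, s)) (\<zero>\<^bsub>Pt C B\<^esub> (g, s) (f, r))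
      (ide (Pt C B) (g, s)) = ((g, s), e2 C p q g r, E)"
  proof (rule Pt.product_eqI[OF prod P2(1)])
    show "((g, s), e2 C p q g r, E) \<in> hom (Pt C B) (g, s) (src (Pt C B) (E, p, (f, r)))"
      using I2 by simp
  qed (unfold P2(2,3), unfold zero_mor_Pt[OF B g f], use i2 in simp_all)
  have hx: "((f, r), x, (t, \<sigma>)) \<in> hom (Pt C B) (f, r) (t, \<sigma>)"
    and hy: "((g, s), y, (t, \<sigma>)) \<in> hom (Pt C B) (g, s) (t, \<sigma>)"
    using f g t x y by (simp_all add: hom_Pt_iff)
  have "huq_commute (Pt C B) ((f, r), x, (t, \<sigma>)) ((g, s), y, (t, \<sigma>)) \<longleftrightarrow>
      (\<exists>\<phi>\<in>hom (Pt C B) E (t, \<sigma>). \<phi> \<cdot>\<^bsub>Pt C B\<^esub> ((f, r), e1 C p q f s, E) = ((f, r), x, (t, \<sigma>)) \<and>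
        \<phi> \<cdot>\<^bsub>Pt C B\<^esub> ((g, s), e2 C p q g r, E) = ((g, s), y, (t, \<sigma>)))"
    using Pt.huq_commute_iff[OF hx hy prod] unfolding pair1 pair2 by simp
  also have "\<dots> \<longleftrightarrow> (\<exists>\<phi>. is_point_mor C E \<phi> (t, \<sigma>) \<and>
      \<phi> \<cdot> e1 C p q f s = x \<and> \<phi> \<cdot> e2 C p q g r = y)"
    using E(1) t unfolding Bex_def hom_Pt_iff by fastforce
  also have "\<dots> \<longleftrightarrow> (\<exists>\<phi>\<in>hom C (src C p) (src C t). \<phi> \<cdot> e1 C p q f s = x \<and> \<phi> \<cdot> e2 C p q g r = y)"
  proof -
    \<comment> \<open>Compatibility with the sections needs only the restriction of \<open>\<phi>\<close> along \<open>e1\<close>, whereas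
      compatibility with the projections is checked on \<open>e1\<close> and \<open>e2\<close> together.\<close>
    have "is_point_mor C E \<phi> (t, \<sigma>) \<longleftrightarrow> \<phi> \<in> hom C (src C p) (src C t)"
      if \<phi>x: "\<phi> \<cdot> e1 C p q f s = x" and \<phi>y: "\<phi> \<cdot> e2 C p q g r = y" for \<phi>
    proof
      assume "is_point_mor C E \<phi> (t, \<sigma>)"
      then show "\<phi> \<in> hom C (src C p) (src C t)" using E(4) by (simp add: is_point_mor_def E_def)
    next
      assume \<phi>: "\<phi> \<in> hom C (src C p) (src C t)"
      have "t \<cdot> \<phi> = f \<cdot> p"
      proof (rule pullback_injections_cancel[OF f g pb cmp_in_hom[OF \<phi> th(1)] cmp_in_hom[OF pq(2) fh(1)]])
        show "(t \<cdot> \<phi>) \<cdot> e1 C p q f s = (f \<cdot> p) \<cdot> e1 C p q f s"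
          using cmp_assoc[OF i1(1) \<phi> th(1)] \<phi>x xh fp1 by simp
        show "(t \<cdot> \<phi>) \<cdot> e2 C p q g r = (f \<cdot> p) \<cdot> e2 C p q g r"
          using cmp_assoc[OF i2(1) \<phi> th(1)] \<phi>y yh fp2 by simp
      qed
      moreover have "\<phi> \<cdot> pair C p q r s = \<sigma>"
        using E(5) cmp_reassoc[OF \<phi>x fh(2) i1(1) \<phi>] xh(3) by simp
      ultimately show "is_point_mor C E \<phi> (t, \<sigma>)"
        using \<phi> E(4) by (simp add: is_point_mor_def E_def)
    qed
    then show ?thesis by blast
  qed
  also have "\<dots> \<longleftrightarrow> left_split_commute C f x r g y s"
    using left_split_commute_iff[OF f g pb xh(1) yh(1)] by simp
  finally show ?thesis .
qed


section \<open>The equivalence of the three conditions\<close>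

lemma (in pointed_pullback_category) Ker_mor_props:
  assumes f: "is_point C B (f, r)" and t: "is_point C B (t, \<sigma>)" and x: "is_point_mor C (f, r) x (t, \<sigma>)"
  shows "Ker_mor C ((f, r), x, (t, \<sigma>)) \<in> hom C (src C (ker C f)) (src C (ker C t))"
    and "ker C t \<cdot> Ker_mor C ((f, r), x, (t, \<sigma>)) = x \<cdot> ker C f"
proof -
  note fh = pointD[OF f] and th = pointD[OF t] and xh = point_morD[OF x]
  note kf = is_kernel_ker[OF fh(1)] and kt = is_kernel_ker[OF th(1)]
  note kfh = kernelD[OF kf fh(1)] and kth = kernelD[OF kt th(1)]
  have "t \<cdot> (x \<cdot> ker C f) = \<zero> (src C (ker C f)) B"
    using cmp_reassoc[OF xh(2) kfh(1) xh(1) th(1)] kfh(2) by simp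
  from kernel_ex[OF kt th(1) cmp_in_hom[OF kfh(1) xh(1)] this]
  have "\<exists>!h. h \<in> hom C (src C (ker C f)) (src C (ker C t)) \<and> ker C t \<cdot> h = x \<cdot> ker C f"
    using kernel_eqI[OF kt] by metis
  from theI'[OF this]
  show "Ker_mor C ((f, r), x, (t, \<sigma>)) \<in> hom C (src C (ker C f)) (src C (ker C t))"
    and "ker C t \<cdot> Ker_mor C ((f, r), x, (t, \<sigma>)) = x \<cdot> ker C f"
    by (simp_all add: Ker_mor_def Ker_ob_def)
qed

context pointed_regular_weakly_maltsev_category
begin

text \<open>A morphism of points \<open>x : (f, r) \<rightarrow> (t, \<sigma>)\<close> is a left split span \<open>(f, x, r)\<close>, whose zero-class is
  \<open>Ker x\<close> followed by the kernel of \<open>t\<close>. The two spans obtained from a cospan agree on \<open>B\<close> because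
  \<open>x r = \<sigma> = y s\<close>.\<close>

lemma Ker_reflects_huq_if_split_spans_commute:
  assumes spans: "split_spans_commute_if_zero_classes_do C"
  shows "Ker_reflects_huq C"
  unfolding Ker_reflects_huq_def
proof (intro ballI impI)
  fix B x' y' assume B: "B \<in> ob C" and x': "x' \<in> mor (Pt C B)" and y': "y' \<in> mor (Pt C B)"
    and tgt: "tgt (Pt C B) x' = tgt (Pt C B) y'" and huq: "huq_commute C (Ker_mor C x') (Ker_mor C y')"
  obtain f r x t \<sigma> where x'_eq: "x' = ((f, r), x, (t, \<sigma>))" by (metis surj_pair)
  obtain g s y where y'_eq: "y' = ((g, s), y, (t, \<sigma>))" using tgt x'_eq by (cases y') auto
  have f: "is_point C B (f, r)" and g: "is_point C B (g, s)" and t: "is_point C B (t, \<sigma>)"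
    and x: "is_point_mor C (f, r) x (t, \<sigma>)" and y: "is_point_mor C (g, s) y (t, \<sigma>)"
    using x' y' unfolding x'_eq y'_eq mor_Pt_iff by blast+
  note fh = pointD[OF f] and gh = pointD[OF g] and th = pointD[OF t]
  note xh = point_morD[OF x] and yh = point_morD[OF y]
  note kx = Ker_mor_props[OF f t x] and ky = Ker_mor_props[OF g t y]
  have kt: "ker C t \<in> hom C (src C (ker C t)) (src C t)"
    using kernelD(1)[OF is_kernel_ker[OF th(1)] th(1)] .
  have "is_zero_class C f x (x \<cdot> ker C f)" "is_zero_class C g y (y \<cdot> ker C g)"
    using zero_class_iff[OF fh(1) xh(1)] zero_class_iff[OF gh(1) yh(1)]
      is_kernel_ker[OF fh(1)] is_kernel_ker[OF gh(1)] by blast+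
  moreover have "huq_commute C (x \<cdot> ker C f) (y \<cdot> ker C g)"
    using huq_commute_postcompose[OF huq[unfolded x'_eq y'_eq] kx(1) ky(1) kt] kx(2) ky(2) by simp
  moreover have "left_split_span C B (src C t) f x r" "left_split_span C B (src C t) g y s"
    using fh gh xh yh by (simp_all add: left_split_span_def)
  moreover have "src C t \<in> ob C" "x \<cdot> r = y \<cdot> s" using hom_ob th xh yh by auto
  ultimately have "left_split_commute C f x r g y s"
    using spans B unfolding split_spans_commute_if_zero_classes_do_def by blast
  then show "huq_commute (Pt C B) x' y'"
    unfolding x'_eq y'_eq using huq_commute_Pt_iff_left_split_commute[OF B f g t x y] by simp
qed

text \<open>The hypothesis \<open>\<alpha> r = \<gamma> s\<close> is what makes \<open>\<langle>f, \<alpha>\<rangle>\<close> and \<open>\<langle>g, \<gamma>\<rangle>\<close> morphisms into one and the same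
  point, the projection \<open>B \<times> D \<rightarrow> B\<close> with section \<open>\<sigma> = \<langle>1, \<alpha> r\<rangle>\<close>. Once these commute, so do their
  second components.\<close>

lemma split_spans_commute_if_Ker_reflects_huq:
  assumes reflects: "Ker_reflects_huq C"
  shows "split_spans_commute_if_zero_classes_do C"
  unfolding split_spans_commute_if_zero_classes_do_def
proof (intro ballI allI impI, elim conjE)
  fix B D f \<alpha> r g \<gamma> s i j
  assume B: "B \<in> ob C" and D: "D \<in> ob C"
    and span_f: "left_split_span C B D f \<alpha> r" and span_g: "left_split_span C B D g \<gamma> s"
    and agree: "\<alpha> \<cdot> r = \<gamma> \<cdot> s" and i: "is_zero_class C f \<alpha> i" and j: "is_zero_class C g \<gamma> j"
    and huq: "huq_commute C i j"
  note f = left_split_spanD(1)[OF span_f] and \<alpha> = left_split_spanD(2)[OF span_f]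
  note g = left_split_spanD(1)[OF span_g] and \<gamma> = left_split_spanD(2)[OF span_g]
  note fh = pointD[OF f] and gh = pointD[OF g]
  note idB = ide_in_hom[OF B] and idD = ide_in_hom[OF D] and zDB = zero_in_hom[OF D B]
  obtain p q where prod: "is_product C B D p q" using ex_product B D by blast
  note pq = productD[OF prod]
  define \<sigma> where "\<sigma> = pair C p q (ide C B) (\<alpha> \<cdot> r)"
  note \<sigma> = product_pair[OF prod idB cmp_in_hom[OF fh(2) \<alpha>], folded \<sigma>_def]
  have t: "is_point C B (p, \<sigma>)" using pq \<sigma> by (simp add: is_point_def)
  define n where "n = pair C p q (\<zero> D B) (ide C D)"
  note n = product_pair[OF prod zDB idD, folded n_def]
  note kp = is_kernel_ker[OF pq(1)]
  obtain u where u: "u \<in> hom C D (src C (ker C p))" "ker C p \<cdot> u = n"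
    using kernel_ex[OF kp pq(1) n(1,2)] by blast
  note kph = kernelD[OF kp pq(1)]
  \<comment> \<open>The chosen kernels agree with \<open>D\<close> and with the domain of the zero-class \<open>l'\<close> only up to the
    comparisons \<open>u\<close> and \<open>a\<close>; Huq-commutativity is insensitive to them.\<close>
  have key: "is_point_mor C (h, w) (pair C p q h \<beta>) (p, \<sigma>)"
    "\<exists>a. a \<in> hom C (src C (ker C h)) (src C l) \<and> l' \<in> hom C (src C l) D \<and>
       Ker_mor C ((h, w), pair C p q h \<beta>, (p, \<sigma>)) = (u \<cdot> l') \<cdot> a"
    if h: "is_point C B (h, w)" and \<beta>: "\<beta> \<in> hom C (src C h) D" and \<beta>w: "\<beta> \<cdot> w = \<alpha> \<cdot> r"
      and l: "is_kernel C h l" and l': "l' = \<beta> \<cdot> l" for h w \<beta> l l'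
  proof -
    note hh = pointD[OF h] and m = product_pair[OF prod pointD(1)[OF h] \<beta>]
    have "pair C p q h \<beta> \<cdot> w = \<sigma>" using cmp_pair[OF prod hh(1) \<beta> hh(2)] \<beta>w hh(3) \<sigma>_def by simp
    then show pm: "is_point_mor C (h, w) (pair C p q h \<beta>) (p, \<sigma>)"
      using m by (simp add: is_point_mor_def)
    note kh = is_kernel_ker[OF hh(1)]
    note khh = kernelD[OF kh hh(1)] and lh = kernelD[OF l hh(1)]
    obtain a where a: "a \<in> hom C (src C (ker C h)) (src C l)" "l \<cdot> a = ker C h"
      using kernel_ex[OF l hh(1) khh] by blast
    have l'h: "l' \<in> hom C (src C l) D" using cmp_in_hom[OF lh(1) \<beta>] l' by simp
    note K = Ker_mor_props[OF h t pm] and ul' = cmp_in_hom[OF l'h u(1)]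
    have l'a: "l' \<cdot> a = \<beta> \<cdot> ker C h" using cmp_assoc[OF a(1) lh(1) \<beta>] a(2) l' by simp
    note \<beta>k = cmp_in_hom[OF khh(1) \<beta>]
    have "ker C p \<cdot> ((u \<cdot> l') \<cdot> a) = n \<cdot> (\<beta> \<cdot> ker C h)"
      using cmp_assoc[OF a(1) l'h u(1)] cmp_reassoc[OF u(2) cmp_in_hom[OF a(1) l'h] u(1) kph(1)] l'a by simp
    also have "\<dots> = pair C p q h \<beta> \<cdot> ker C h"
      using cmp_pair[OF prod zDB idD \<beta>k] cmp_pair[OF prod hh(1) \<beta> khh(1)] zero_left[OF B \<beta>k]
        cmp_ide_left[OF \<beta>k] khh(2) by (simp add: n_def)
    finally have "Ker_mor C ((h, w), pair C p q h \<beta>, (p, \<sigma>)) = (u \<cdot> l') \<cdot> a"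
      using kernel_eqI[OF kp K(1) cmp_in_hom[OF a(1) ul']] K(2) by simp
    then show "\<exists>a. a \<in> hom C (src C (ker C h)) (src C l) \<and> l' \<in> hom C (src C l) D \<and>
       Ker_mor C ((h, w), pair C p q h \<beta>, (p, \<sigma>)) = (u \<cdot> l') \<cdot> a" using a(1) l'h by blast
  qed
  obtain k where k: "is_kernel C f k" "i = \<alpha> \<cdot> k" using i zero_class_iff[OF fh(1) \<alpha>] by blast
  obtain l where l: "is_kernel C g l" "j = \<gamma> \<cdot> l" using j zero_class_iff[OF gh(1) \<gamma>] by blast
  let ?x = "pair C p q f \<alpha>" and ?y = "pair C p q g \<gamma>"
  note x = key(1)[OF f \<alpha> refl k] and y = key(1)[OF g \<gamma> agree[symmetric] l]
  obtain a where a: "a \<in> hom C (src C (ker C f)) (src C k)" "i \<in> hom C (src C k) D"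
    "Ker_mor C ((f, r), ?x, (p, \<sigma>)) = (u \<cdot> i) \<cdot> a" using key(2)[OF f \<alpha> refl k] by blast
  obtain b where b: "b \<in> hom C (src C (ker C g)) (src C l)" "j \<in> hom C (src C l) D"
    "Ker_mor C ((g, s), ?y, (p, \<sigma>)) = (u \<cdot> j) \<cdot> b" using key(2)[OF g \<gamma> agree[symmetric] l] by blast
  have "huq_commute C ((u \<cdot> i) \<cdot> a) ((u \<cdot> j) \<cdot> b)"
    by (rule huq_commute_precompose[OF huq_commute_postcompose[OF huq a(2) b(2) u(1)]
        cmp_in_hom[OF a(2) u(1)] cmp_in_hom[OF b(2) u(1)] a(1) b(1)])
  then have "huq_commute C (Ker_mor C ((f, r), ?x, (p, \<sigma>))) (Ker_mor C ((g, s), ?y, (p, \<sigma>)))"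
    using a(3) b(3) by simp
  moreover have "((f, r), ?x, (p, \<sigma>)) \<in> mor (Pt C B)" "((g, s), ?y, (p, \<sigma>)) \<in> mor (Pt C B)"
    using f g t x y by (simp_all add: mor_Pt_iff)
  ultimately have "huq_commute (Pt C B) ((f, r), ?x, (p, \<sigma>)) ((g, s), ?y, (p, \<sigma>))"
    using reflects B unfolding Ker_reflects_huq_def by simp
  then have comm: "left_split_commute C f ?x r g ?y s"
    using huq_commute_Pt_iff_left_split_commute[OF B f g t x y] by simp
  show "left_split_commute C f \<alpha> r g \<gamma> s"
    using left_split_commute_postcompose[OF comm f g point_morD(1)[OF x] point_morD(1)[OF y] pq(2)]
      product_pair(3)[OF prod fh(1) \<alpha>] product_pair(3)[OF prod gh(1) \<gamma>] by simp
qed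

lemma split_relations_commute_if_split_spans_commute:
  "split_spans_commute_if_zero_classes_do C \<Longrightarrow> split_relations_commute_if_zero_classes_do C"
  unfolding split_relations_commute_if_zero_classes_do_def split_spans_commute_if_zero_classes_do_def
    left_split_relation_def by blast

text \<open>The relation is the regular image of the span; its splitting is \<open>e r\<close>. The factorisation
  \<open>i = i' e'\<close> is the one along which commutativity of zero-classes descends.\<close>

lemma relation_of_split_span:
  assumes span: "left_split_span C B D f \<alpha> r" and i: "is_zero_class C f \<alpha> i"
  obtains A' e f' \<alpha>' X i' e' where "e \<in> hom C (src C f) A'" "f' \<in> hom C A' B" "\<alpha>' \<in> hom C A' D"
    "f' \<cdot> e = f" "\<alpha>' \<cdot> e = \<alpha>" "left_split_relation C B D f' \<alpha>' (e \<cdot> r)"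
    "is_zero_class C f' \<alpha>' i'" "regular_epi C e'" "e' \<in> hom C (src C i) X" "i' \<in> hom C X D" "i = i' \<cdot> e'"
proof -
  note f = left_split_spanD(1)[OF span] and \<alpha> = left_split_spanD(2)[OF span]
  note fh = pointD[OF f]
  obtain A' e f' \<alpha>' where e: "e \<in> hom C (src C f) A'" and epi: "regular_epi C e"
    and f': "f' \<in> hom C A' B" and \<alpha>': "\<alpha>' \<in> hom C A' D" and eqs: "f' \<cdot> e = f" "\<alpha>' \<cdot> e = \<alpha>"
    and monic: "jointly_monic C f' \<alpha>'"
    by (rule regular_image_of_pair[OF fh(1) \<alpha>])
  have rel: "left_split_relation C B D f' \<alpha>' (e \<cdot> r)"
    using monic f' \<alpha>' hom_src[OF f'] cmp_in_hom[OF fh(2) e] cmp_reassoc[OF eqs(1) fh(2) e f'] fh(3)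
      cmp_assoc[OF fh(2) e f'] eqs
    by (simp add: left_split_relation_def left_split_span_def)
  obtain k where k: "is_kernel C f k" "i = \<alpha> \<cdot> k" using i zero_class_iff[OF fh(1) \<alpha>] by blast
  obtain k' where k': "is_kernel C f' k'" using ex_kernel[OF f'] by blast
  note kh = kernelD[OF k(1) fh(1)] and k'h = kernelD[OF k' f']
  have "is_kernel C (f' \<cdot> e) k" using k(1) eqs(1) by simp
  then obtain e' where e': "e' \<in> hom C (src C k) (src C k')" "k' \<cdot> e' = e \<cdot> k" "regular_epi C e'"
    by (rule kernel_comparison_regular_epi[OF e epi f' _ k'])
  have src: "src C i = src C k" using hom_src[OF cmp_in_hom[OF kh(1) \<alpha>]] k(2) by simp
  have "i = (\<alpha>' \<cdot> k') \<cdot> e'"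
    using cmp_assoc[OF e'(1) k'h(1) \<alpha>'] e'(2) cmp_reassoc[OF eqs(2) kh(1) e \<alpha>'] k(2) by simp
  moreover have "is_zero_class C f' \<alpha>' (\<alpha>' \<cdot> k')" using zero_class_iff[OF f' \<alpha>'] k' by blast
  ultimately show ?thesis
    using that[OF e f' \<alpha>' eqs rel _ e'(3) _ cmp_in_hom[OF k'h(1) \<alpha>']] e'(1) src by simp
qed

text \<open>Descent is applied to one variable at a time, so that no composition of regular epimorphisms
  is involved. The connecting morphism of the images, precomposed with the regular epimorphisms,
  connects the original spans.\<close>

lemma split_spans_commute_if_split_relations_commute:
  assumes relations: "split_relations_commute_if_zero_classes_do C"
  shows "split_spans_commute_if_zero_classes_do C"
  unfolding split_spans_commute_if_zero_classes_do_def
proof (intro ballI allI impI, elim conjE)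
  fix B D f \<alpha> r g \<gamma> s i j
  assume B: "B \<in> ob C" and D: "D \<in> ob C"
    and span_f: "left_split_span C B D f \<alpha> r" and span_g: "left_split_span C B D g \<gamma> s"
    and agree: "\<alpha> \<cdot> r = \<gamma> \<cdot> s" and i: "is_zero_class C f \<alpha> i" and j: "is_zero_class C g \<gamma> j"
    and huq: "huq_commute C i j"
  obtain A' a f' \<alpha>' X i' e where a: "a \<in> hom C (src C f) A'" "f' \<in> hom C A' B" "\<alpha>' \<in> hom C A' D"
    "f' \<cdot> a = f" "\<alpha>' \<cdot> a = \<alpha>" and rel_f: "left_split_relation C B D f' \<alpha>' (a \<cdot> r)"
    and i': "is_zero_class C f' \<alpha>' i'" "regular_epi C e" "e \<in> hom C (src C i) X" "i' \<in> hom C X D"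
      "i = i' \<cdot> e"
    by (rule relation_of_split_span[OF span_f i])
  obtain E' b g' \<gamma>' Y j' e' where b: "b \<in> hom C (src C g) E'" "g' \<in> hom C E' B" "\<gamma>' \<in> hom C E' D"
    "g' \<cdot> b = g" "\<gamma>' \<cdot> b = \<gamma>" and rel_g: "left_split_relation C B D g' \<gamma>' (b \<cdot> s)"
    and j': "is_zero_class C g' \<gamma>' j'" "regular_epi C e'" "e' \<in> hom C (src C j) Y" "j' \<in> hom C Y D"
      "j = j' \<cdot> e'"
    by (rule relation_of_split_span[OF span_g j])
  note f = left_split_spanD(1)[OF span_f] and g = left_split_spanD(1)[OF span_g]
  have "j \<in> hom C (src C j) D" using cmp_in_hom[OF j'(3,4)] j'(5) by simp
  then have "huq_commute C i' j" using huq_commute_descends[OF _ i'(2,3,4)] huq i'(5) by simp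
  then have "huq_commute C j' i'"
    using huq_commute_descends[OF _ j'(2,3,4) i'(4)] huq_commute_sym j'(5) by simp
  then have "huq_commute C i' j'" by (rule huq_commute_sym)
  moreover have "\<alpha>' \<cdot> (a \<cdot> r) = \<gamma>' \<cdot> (b \<cdot> s)"
    using cmp_reassoc[OF _ pointD(2)[OF f] a(1,3)] cmp_reassoc[OF _ pointD(2)[OF g] b(1,3)]
      a(5) b(5) agree by simp
  ultimately have "left_split_commute C f' \<alpha>' (a \<cdot> r) g' \<gamma>' (b \<cdot> s)"
    using relations B D rel_f rel_g i'(1) j'(1)
    unfolding split_relations_commute_if_zero_classes_do_def by blast
  from left_split_commute_precompose[OF this a(2) b(2) a(3) b(3) _ _ a(1) b(1)] f g
  show "left_split_commute C f \<alpha> r g \<gamma> s" unfolding a(4,5) b(4,5) by blast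
qed

end

theorem proposition4p5:
  fixes C :: "('o, 'm) cat"
  assumes "pointed C" and "regular C" and "weakly_maltsev C"
  shows "(Ker_reflects_huq C \<longleftrightarrow> split_relations_commute_if_zero_classes_do C) \<and>
         (split_relations_commute_if_zero_classes_do C \<longleftrightarrow>
           split_spans_commute_if_zero_classes_do C)"
proof -
  interpret category C using assms(1) by (simp add: pointed_def)
  interpret pointed_regular_weakly_maltsev_category C using assms by unfold_locales
  show ?thesis
    using Ker_reflects_huq_if_split_spans_commute split_spans_commute_if_Ker_reflects_huq
      split_relations_commute_if_split_spans_commute split_spans_commute_if_split_relations_commute
    by blast
qed

end
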